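(* Let $p:[-1,1]\to[1,\infty)$ be continuous. Suppose that $p$ is even and that the function $K(s,x)=s\,(1+s^{-2})^{\frac{p(x)}{2}}$ is jointly convex in $(s,x)$ on $(0,\infty)\times[-1,1]$. Then for every nonnegative function $u\in\mathring{W}{}^1_1(-1,1)$ the inequality $\mathcal I(u^* )\le\mathcal I(u)$ holds, where $\mathcal I(u)=\int_{-1}^{1}(1+|u'(x)|^2)^{p(x)/2}\,dx\in[0,\infty]$ and $u^*$ is the symmetrization of $u$.
   Context: $\mathring{W}{}^1_1(-1,1)$ is the Sobolev space of absolutely continuous functions on $[-1,1]$ with integrable derivative that vanish at $\pm1$. For a measurable set $E\subset[-1,1]$ put $E^*=\left[-\frac{|E|}{2},\frac{|E|}{2}\right]$, where $|E|$ is Lebesgue measure. For a nonnegative $u\in\mathring{W}{}^1_1(-1,1)$ put $\mathcal A_t=\{x\in[-1,1]: u(x)>t\}$; the symmetrization (symmetric rearrangement) of $u$ is $u^*(x)=\int_0^\infty \chi_{\mathcal A_t^*}(x)\,dt$, where $\chi$ denotes the characteristic function. The value $\mathcal I=+\infty$ is allowed (the inequality then holds trivially if $\mathcal I(u)=\infty$). *)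

theory Defs
  imports "HOL-Analysis.Analysis"
begin

definition absolutely_continuous_on :: "real set \<Rightarrow> (real \<Rightarrow> real) \<Rightarrow> bool" where
  "absolutely_continuous_on S f \<longleftrightarrow>
     (\<forall>\<epsilon>>0. \<exists>\<delta>>0. \<forall>D :: (real \<times> real) set.
        finite D \<longrightarrow>
        (\<forall>(a, b)\<in>D. a \<le> b \<and> {a..b} \<subseteq> S) \<longrightarrow>
        disjoint_family_on (\<lambda>(a, b). {a<..<b}) D \<longrightarrow>
        (\<Sum>(a, b)\<in>D. b - a) < \<delta> \<longrightarrow>
        (\<Sum>(a, b)\<in>D. \<bar>f b - f a\<bar>) < \<epsilon>)"

text \<open>
  Functions on \<open>[-1,1]\<close> are represented by total functions on the reals; only their values on
  \<open>[-1,1]\<close> matter. The term \<open>deriv u x\<close> is the classical two-sided derivative, meaningful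
  where \<open>u\<close> is differentiable. For an absolutely continuous \<open>u\<close> this is almost every point of
  \<open>[-1,1]\<close>, so the second conjunct below is implied by the first (as is the integrability); it is
  stated so that the third visibly concerns the almost everywhere defined derivative.
\<close>

definition sobolev_W11_0 :: "(real \<Rightarrow> real) set" where
  "sobolev_W11_0 = {u.
     absolutely_continuous_on {-1..1} u \<and>
     (AE x in lebesgue. x \<in> {-1..1} \<longrightarrow> u differentiable (at x)) \<and>
     set_integrable lebesgue {-1..1} (deriv u) \<and>
     u (-1) = 0 \<and> u 1 = 0}"

text \<open>
  The formula \<open>[-|E|/2, |E|/2]\<close> would turn the empty set into \<open>{0}\<close>, and the rearrangement of
  every function would be infinite at \<open>0\<close>. The degenerate interval is therefore read as the empty
  set when \<open>E\<close> is empty. This affects the rearrangement at the single point \<open>0\<close> only.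
\<close>

definition symmetrized_set :: "real set \<Rightarrow> real set" where
  "symmetrized_set E =
     (if E = {} then {} else {- (measure lebesgue E / 2) .. measure lebesgue E / 2})"

definition superlevel :: "(real \<Rightarrow> real) \<Rightarrow> real \<Rightarrow> real set" where
  "superlevel u t = {x \<in> {-1..1}. u x > t}"

definition symmetrization :: "(real \<Rightarrow> real) \<Rightarrow> real \<Rightarrow> real" where
  "symmetrization u x = (LINT t:{0..}|lebesgue. indicator (symmetrized_set (superlevel u t)) x)"

definition energy :: "(real \<Rightarrow> real) \<Rightarrow> (real \<Rightarrow> real) \<Rightarrow> ennreal" where
  "energy p u = (\<integral>\<^sup>+x\<in>{-1..1}. ennreal ((1 + \<bar>deriv u x\<bar>\<^sup>2) powr (p x / 2)) \<partial>lebesgue)"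

end

theory Submission
  imports Defs
begin

text \<open>
  Write \<open>w\<close> for the symmetrization of \<open>u\<close> and \<open>excess p x q\<close> for \<open>(1 + q\<^sup>2) powr (p x / 2) - 1\<close>, so that
  the energy of a function is \<open>2\<close> plus the integral of the excess of its derivative. The excess is
  nonnegative and vanishes for \<open>q = 0\<close>. Hence parts of the graph of \<open>u\<close> may be thrown away, and
  only the points where \<open>w\<close> has a nonzero derivative have to be paid for.

  Let \<open>0 < x < 1\<close> be such a point, and suppose that \<open>u\<close> has a nonzero derivative wherever it takes
  the value \<open>w x\<close> inside the interval. Let \<open>l x\<close> and \<open>r x\<close> be the first and the last point where
  \<open>u\<close> reaches this level. Then \<open>l\<close> and \<open>r\<close> are differentiable at \<open>x\<close>, with derivatives \<open>-a < 0\<close> and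
  \<open>b > 0\<close>, and \<open>u\<close> has slopes of modulus \<open>q / a\<close> and \<open>q / b\<close> there, where \<open>q\<close> is the modulus of the
  slope of \<open>w\<close> at \<open>x\<close>.
  The superlevel sets of \<open>u\<close> obey \<open>|{u > w x}| \<le> 2 x \<le> |{u \<ge> w x}|\<close>. This yields \<open>r x - l x \<ge> 2 x\<close>,
  and, comparing two nearby levels, \<open>a + b \<le> 2\<close>: from one level to a slightly higher one, the
  superlevel set loses at least what it loses at its two ends. These two inequalities hold although \<open>u\<close> may cross the
  level many times between \<open>l x\<close> and \<open>r x\<close>.

  The hypothesis on \<open>K(s, x) = s (1 + 1/s\<^sup>2) powr (p x / 2)\<close> enters through
  \<open>q K(a/q, y) = a (1 + excess p y (q/a))\<close>. Since \<open>K\<close> grows in \<open>s\<close> with slope at most one, the deficit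
  \<open>2 - a - b\<close> can be added to one of the two branches; joint convexity and evenness then bound
  \<open>2 K(1/q, (r x - l x) / 2)\<close>, and evenness with convexity in \<open>x\<close> allows to pass from
  \<open>(r x - l x) / 2\<close> to the smaller argument \<open>x\<close>. The result, \<open>excess_two_branches\<close>, reads
  \<open>2 excess(x, q) \<le> a excess(l x, q/a) + b excess(r x, q/b)\<close>. Integrated over \<open>x\<close>, the right-hand
  side is, by the change of variables \<open>y = l x\<close> and \<open>y = r x\<close>, the integral of the excess of \<open>u\<close> over two
  disjoint sets.

  It remains to see that the exceptional points do not matter. As a function that is monotone on each
  half line, \<open>w\<close> is differentiable almost everywhere (\<open>mono_differentiable_ae\<close>). The exceptional
  levels are values of \<open>u\<close> on a null set or critical values of \<open>u\<close>. The former form a null set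
  because \<open>u\<close> is absolutely continuous (\<open>absolutely_continuous_on_negligible_image\<close>), the latter by
  Sard's theorem in dimension one. The points where \<open>w\<close> takes a value from a null set and has a
  nonzero derivative form a null set, too (\<open>irregular_points_negligible\<close>).
\<close>

section \<open>Monotone functions are differentiable almost everywhere\<close>

text \<open>
  Vitali's covering theorem in the form used for difference quotients, where the intervals that shrink to
  a point \<open>x\<close> of \<open>S\<close> have \<open>x\<close> as an end point.
  The end points of a countable family form a null set, which is why open intervals suffice at the end.
\<close>

lemma vitali_intervals:
  fixes S :: "real set"
  assumes "\<And>x e. x \<in> S \<Longrightarrow> 0 < e \<Longrightarrow> \<exists>c d. c < d \<and> x \<in> {c..d} \<and> d - c < e \<and> P c d"
  obtains C where "countable C" "\<And>c d. (c, d) \<in> C \<Longrightarrow> c < d \<and> P c d"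
    "disjoint_family_on (\<lambda>(c, d). {c..d}) C"
    "negligible (S - (\<Union>(c, d)\<in>C. {c<..<d}))"
proof -
  define K where "K = {(c, d). c < d \<and> P c d}"
  let ?a = "\<lambda>(c, d). (c + d) / 2 :: real" and ?r = "\<lambda>(c, d). (d - c) / 2 :: real"
  have ball: "cball (?a i) (?r i) = (\<lambda>(c, d). {c..d}) i" for i
    by (cases i) (auto simp: cball_def dist_real_def abs_le_iff field_simps)
  obtain C where C: "countable C" "C \<subseteq> K"
     "pairwise (\<lambda>i j. disjnt (cball (?a i) (?r i)) (cball (?a j) (?r j))) C"
     "negligible (S - (\<Union>i\<in>C. cball (?a i) (?r i)))"
  proof (rule Vitali_covering_theorem_cballs[of K ?r S ?a])
    show "0 < ?r i" if "i \<in> K" for i using that by (auto simp: K_def)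
    show "\<exists>i. i \<in> K \<and> x \<in> cball (?a i) (?r i) \<and> ?r i < d" if x: "x \<in> S" "0 < d" for x d
    proof -
      from assms[OF x] obtain c d' where "c < d'" "x \<in> {c..d'}" "d' - c < d" "P c d'" by blast
      then show ?thesis unfolding ball by (intro exI[of _ "(c, d')"]) (auto simp: K_def)
    qed
  qed
  show ?thesis
  proof
    show "countable C" by fact
    show "c < d \<and> P c d" if "(c, d) \<in> C" for c d using that C(2) by (auto simp: K_def)
    show "disjoint_family_on (\<lambda>(c, d). {c..d}) C"
      using C(3) unfolding ball by (auto simp: disjoint_family_on_def pairwise_def disjnt_def)
    have "negligible (fst ` C \<union> snd ` C)"
      using C(1) by (auto intro!: null_sets_completionI countable_imp_null_set_lborel
          simp: negligible_iff_null_sets)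
    moreover have "S - (\<Union>(c, d)\<in>C. {c<..<d})
      \<subseteq> (S - (\<Union>i\<in>C. cball (?a i) (?r i))) \<union> (fst ` C \<union> snd ` C)"
      unfolding ball by (force simp: image_iff)
    ultimately show "negligible (S - (\<Union>(c, d)\<in>C. {c<..<d}))"
      using C(4) by (meson negligible_Un negligible_subset)
  qed
qed

text \<open>
  The intervals between \<open>f c\<close> and \<open>f d\<close> are disjoint subsets of the interval between \<open>f a\<close> and
  \<open>f b\<close>, so that the countable additivity of Lebesgue measure does the summation.
\<close>

lemma increments_sum_le:
  fixes f :: "real \<Rightarrow> real"
  assumes f: "mono f" and C: "countable C" "\<And>c d. (c, d) \<in> C \<Longrightarrow> a \<le> c \<and> c < d \<and> d \<le> b"
    "disjoint_family_on (\<lambda>(c, d). {c..d}) C"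
  shows "(\<integral>\<^sup>+(c, d). ennreal (f d - f c) \<partial>count_space C) \<le> ennreal (f b - f a)"
proof (cases "C = {}")
  case False
  then have "a \<le> b" using C(2) by fastforce
  let ?J = "\<lambda>(c, d). {f c<..<f d}"
  have *: "?J i \<inter> ?J j = {}" if ij: "i \<in> C" "j \<in> C" "i \<noteq> j" for i j
  proof -
    obtain c d c' d' where [simp]: "i = (c, d)" "j = (c', d')" by (cases i, cases j)
    have "{c..d} \<inter> {c'..d'} = {}" using disjoint_family_onD[OF C(3) ij] by simp
    moreover have "c < d" "c' < d'" using C(2) ij by auto
    ultimately have "d < c' \<or> d' < c"
      by (metis atLeastAtMost_iff disjoint_iff less_eq_real_def linorder_not_less)
    then have "f d \<le> f c' \<or> f d' \<le> f c" using f by (auto simp: mono_def)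
    then show ?thesis by auto
  qed
  have "(\<integral>\<^sup>+i. emeasure lborel (?J i) \<partial>count_space C) = emeasure lborel (\<Union>i\<in>C. ?J i)"
    using C(1) * by (intro emeasure_UN_countable[symmetric]) (auto simp: disjoint_family_on_def)
  also have "\<dots> \<le> emeasure lborel {f a..f b}"
    using C(2) f by (intro emeasure_mono) (fastforce dest: monoD)+
  also have "\<dots> = ennreal (f b - f a)"
    using f \<open>a \<le> b\<close> by (simp add: monoD)
  also have "(\<integral>\<^sup>+i. emeasure lborel (?J i) \<partial>count_space C)
      = (\<integral>\<^sup>+(c, d). ennreal (f d - f c) \<partial>count_space C)"
    using C(2) f by (intro nn_integral_cong) (force simp: monoD)
  finally show ?thesis .
qed (simp add: nn_integral_empty)

definition difference_quotient :: "(real \<Rightarrow> real) \<Rightarrow> real \<Rightarrow> real \<Rightarrow> real" where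
  "difference_quotient f x y = (f y - f x) / (y - x)"

lemma disjoint_family_on_shrink:
  assumes "disjoint_family_on A I" "\<And>i. i \<in> I \<Longrightarrow> B i \<subseteq> A i"
  shows "disjoint_family_on B I"
  using assms unfolding disjoint_family_on_def by blast

lemma interval_of_difference_quotient:
  assumes "\<exists>\<^sub>F y in at x. P (difference_quotient f x y)" "0 < e" "open G" "x \<in> G"
  shows "\<exists>c d. c < d \<and> x \<in> {c..d} \<and> d - c < e \<and> {c..d} \<subseteq> G \<and> P ((f d - f c) / (d - c))"
proof -
  obtain r where r: "r > 0" "ball x r \<subseteq> G" using assms(3,4) open_contains_ball by blast
  have "\<forall>\<^sub>F y in at x. dist y x < min r e"
    using r(1) assms(2) by (auto simp: eventually_at intro!: exI[of _ "min r e"])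
  then have "\<forall>\<^sub>F y in at x. y \<noteq> x \<and> dist y x < min r e"
    by (simp add: eventually_conj eventually_at_filter)
  with assms(1) have "\<exists>\<^sub>F y in at x. P (difference_quotient f x y) \<and> y \<noteq> x \<and> dist y x < min r e"
    by (rule frequently_eventually_frequently)
  then obtain y where y: "P (difference_quotient f x y)" "y \<noteq> x" "\<bar>y - x\<bar> < r" "\<bar>y - x\<bar> < e"
    by (auto dest!: frequently_ex simp: dist_real_def)
  define c d where "c = min x y" and "d = max x y"
  have "(f d - f c) / (d - c) = difference_quotient f x y"
    unfolding c_def d_def difference_quotient_def by (cases "x < y") (use y(2) in \<open>auto simp: min_def max_def divide_simps algebra_simps\<close>)
  moreover have "{c..d} \<subseteq> ball x r"
    using y by (auto simp: c_def d_def dist_real_def)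
  ultimately show ?thesis
    using y r by (intro exI[of _ c] exI[of _ d]) (auto simp: c_def d_def)
qed

text \<open>
  A monotone function cannot be steep on a large set: Vitali intervals on which \<open>f\<close> grows by more than
  \<open>q\<close> times their length cover \<open>S\<close>, and their total increment is bounded. As \<open>S\<close> may fail to be
  measurable, the bound is stated for a measurable cover \<open>T\<close>.
\<close>

lemma steep_set_measure:
  fixes f :: "real \<Rightarrow> real"
  assumes f: "mono f" and q: "0 < q" and S: "S \<subseteq> {a<..<b}"
    and steep: "\<And>x. x \<in> S \<Longrightarrow> \<exists>\<^sub>F y in at x. q < difference_quotient f x y"
  obtains T where "T \<in> sets lebesgue" "S \<subseteq> T" "ennreal q * emeasure lebesgue T \<le> ennreal (f b - f a)"
proof -
  have "\<exists>c d. c < d \<and> x \<in> {c..d} \<and> d - c < e \<and> ({c..d} \<subseteq> {a<..<b} \<and> q < (f d - f c) / (d - c))"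
    if "x \<in> S" "0 < e" for x e
  proof -
    have "x \<in> {a<..<b}" using that S by blast
    from interval_of_difference_quotient[where P="\<lambda>z. q < z", OF steep[OF that(1)] that(2) open_greaterThanLessThan this]
    show ?thesis by blast
  qed
  from vitali_intervals[of S "\<lambda>c d. {c..d} \<subseteq> {a<..<b} \<and> q < (f d - f c) / (d - c)", OF this]
  obtain C where C: "countable C"
      "\<And>c d. (c, d) \<in> C \<Longrightarrow> c < d \<and> {c..d} \<subseteq> {a<..<b} \<and> q < (f d - f c) / (d - c)"
      "disjoint_family_on (\<lambda>(c, d). {c..d}) C"
      "negligible (S - (\<Union>(c, d)\<in>C. {c<..<d}))" by blast
  let ?U = "\<Union>(c, d)\<in>C. {c<..<d}"
  have U: "?U \<in> sets lebesgue" using C(1) by auto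
  show ?thesis
  proof
    show "?U \<union> (S - ?U) \<in> sets lebesgue"
      using U C(4) negligible_imp_sets by blast
    have dis: "disjoint_family_on (\<lambda>(c, d). {c<..<d}) C"
      using C(3) by (rule disjoint_family_on_shrink) (auto simp: less_imp_le)
    have "emeasure lebesgue (?U \<union> (S - ?U)) = emeasure lebesgue ?U"
      using C(4) U by (intro emeasure_Un_null_set) (auto simp: negligible_iff_null_sets)
    also have "\<dots> = (\<integral>\<^sup>+i. emeasure lebesgue (case i of (c, d) \<Rightarrow> {c<..<d}) \<partial>count_space C)"
      using C(1) dis by (intro emeasure_UN_countable) auto
    finally have "ennreal q * emeasure lebesgue (?U \<union> (S - ?U)) =
       (\<integral>\<^sup>+i. ennreal q * emeasure lebesgue (case i of (c, d) \<Rightarrow> {c<..<d}) \<partial>count_space C)"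
      by (simp add: nn_integral_cmult)
    also have "\<dots> \<le> (\<integral>\<^sup>+(c, d). ennreal (f d - f c) \<partial>count_space C)"
    proof (intro nn_integral_mono)
      fix i assume "i \<in> space (count_space C)"
      then obtain c d where i: "i = (c, d)" "(c, d) \<in> C" by (cases i) auto
      from C(2)[OF i(2)] have "q * (d - c) \<le> f d - f c" "c < d" by (auto simp: field_simps)
      then show "ennreal q * emeasure lebesgue (case i of (c, d) \<Rightarrow> {c<..<d})
        \<le> (case i of (c, d) \<Rightarrow> ennreal (f d - f c))"
        using q by (auto simp: i ennreal_mult[symmetric] intro!: ennreal_leI)
    qed
    also have "\<dots> \<le> ennreal (f b - f a)"
    proof (rule increments_sum_le[OF f C(1) _ C(3)])
      show "a \<le> c \<and> c < d \<and> d \<le> b" if "(c, d) \<in> C" for c d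
      proof -
        have "c < d" "{c..d} \<subseteq> {a<..<b}" using C(2)[OF that] by auto
        then have "c \<in> {a<..<b}" "d \<in> {a<..<b}" by (meson atLeastAtMost_iff less_imp_le order_refl subsetD)+
        with \<open>c < d\<close> show ?thesis by simp
      qed
    qed
    finally show "ennreal q * emeasure lebesgue (?U \<union> (S - ?U)) \<le> ennreal (f b - f a)" .
  qed auto
qed

text \<open>
  Cover the set, within an arbitrary open set \<open>G\<close>, by Vitali intervals on which \<open>f\<close> grows with mean slope
  less than \<open>p\<close>. Within each of them the set is also steep with slope \<open>q\<close>. So its outer measure \<open>m\<close>
  satisfies \<open>q m \<le> p |G|\<close>, and \<open>G\<close> can be chosen with measure close to \<open>m\<close>. This forces \<open>m = 0\<close>.
\<close>

lemma oscillating_difference_quotient_negligible: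
  fixes f :: "real \<Rightarrow> real"
  assumes f: "mono f" and pq: "0 < p" "p < q"
  shows "negligible {x \<in> {a<..<b}. (\<exists>\<^sub>F y in at x. difference_quotient f x y < p) \<and> (\<exists>\<^sub>F y in at x. q < difference_quotient f x y)}"
    (is "negligible ?E")
proof -
  define m where "m = outer_measure_of lebesgue ?E"
  have bound: "ennreal q * m \<le> ennreal p * emeasure lebesgue G"
    if G: "open G" "?E \<subseteq> G" for G
  proof -
    have "\<exists>c d. c < d \<and> x \<in> {c..d} \<and> d - c < e \<and> ({c..d} \<subseteq> G \<and> (f d - f c) / (d - c) < p)"
      if "x \<in> ?E" "0 < e" for x e
    proof -
      have "x \<in> G" "\<exists>\<^sub>F y in at x. difference_quotient f x y < p" using that G by auto
      from interval_of_difference_quotient[where P="\<lambda>z. z < p", OF this(2) that(2) G(1) this(1)]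
      show ?thesis by blast
    qed
    from vitali_intervals[of ?E "\<lambda>c d. {c..d} \<subseteq> G \<and> (f d - f c) / (d - c) < p", OF this]
    obtain C where C: "countable C"
        "\<And>c d. (c, d) \<in> C \<Longrightarrow> c < d \<and> {c..d} \<subseteq> G \<and> (f d - f c) / (d - c) < p"
        "disjoint_family_on (\<lambda>(c, d). {c..d}) C"
        "negligible (?E - (\<Union>(c, d)\<in>C. {c<..<d}))" by blast
    have "\<exists>T. T \<in> sets lebesgue \<and> ?E \<inter> {fst i<..<snd i} \<subseteq> T \<and>
        ennreal q * emeasure lebesgue T \<le> ennreal (f (snd i) - f (fst i))" for i
    proof -
      obtain T where "T \<in> sets lebesgue" "?E \<inter> {fst i<..<snd i} \<subseteq> T"
          "ennreal q * emeasure lebesgue T \<le> ennreal (f (snd i) - f (fst i))"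
      proof (rule steep_set_measure[OF f, of q "?E \<inter> {fst i<..<snd i}" "fst i" "snd i"])
        show "\<exists>\<^sub>F y in at x. q < difference_quotient f x y" if "x \<in> ?E \<inter> {fst i<..<snd i}" for x
          using that by blast
      qed (use pq in \<open>simp_all\<close>)
      then show ?thesis by blast
    qed
    then obtain T where T: "\<And>i. T i \<in> sets lebesgue" "\<And>i. ?E \<inter> {fst i<..<snd i} \<subseteq> T i"
        "\<And>i. ennreal q * emeasure lebesgue (T i) \<le> ennreal (f (snd i) - f (fst i))"
      using choice[of "\<lambda>i T. T \<in> sets lebesgue \<and> ?E \<inter> {fst i<..<snd i} \<subseteq> T \<and>
        ennreal q * emeasure lebesgue T \<le> ennreal (f (snd i) - f (fst i))"] by blast
    let ?J = "\<lambda>i. {fst i<..<snd i}"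
    have dis: "disjoint_family_on ?J C"
      using C(3) by (rule disjoint_family_on_shrink) (auto simp: less_imp_le)
    have disT: "disjoint_family_on (\<lambda>i. T i \<inter> ?J i) C"
      using dis by (rule disjoint_family_on_shrink) auto
    let ?N = "?E - (\<Union>(c, d)\<in>C. {c<..<d})" and ?V = "\<Union>i\<in>C. T i \<inter> ?J i"
    have V: "?V \<in> sets lebesgue" by (rule sets.countable_UN'[OF C(1)]) (use T(1) in auto)
    have "?E \<subseteq> ?V \<union> ?N"
    proof
      fix x assume x: "x \<in> ?E"
      show "x \<in> ?V \<union> ?N"
      proof (cases "x \<in> (\<Union>(c, d)\<in>C. {c<..<d})")
        case True
        then obtain i where i: "i \<in> C" "x \<in> ?J i" by auto
        with x T(2)[of i] have "x \<in> T i" by blast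
        with i show ?thesis by blast
      qed (use x in blast)
    qed
    then have "m \<le> outer_measure_of lebesgue (?V \<union> ?N)"
      unfolding m_def by (rule outer_measure_of_mono)
    also have "\<dots> = emeasure lebesgue (?V \<union> ?N)"
      using V negligible_imp_sets[OF C(4)] by (intro outer_measure_of_eq sets.Un)
    also have "\<dots> = emeasure lebesgue ?V"
      using C(4) V by (intro emeasure_Un_null_set) (auto simp: negligible_iff_null_sets)
    also have "\<dots> = (\<integral>\<^sup>+i. emeasure lebesgue (T i \<inter> ?J i) \<partial>count_space C)"
      using C(1) T(1) disT by (intro emeasure_UN_countable) auto
    finally have "ennreal q * m \<le> ennreal q * (\<integral>\<^sup>+i. emeasure lebesgue (T i \<inter> ?J i) \<partial>count_space C)"
      by (rule mult_left_mono) simp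
    also have "\<dots> = (\<integral>\<^sup>+i. ennreal q * emeasure lebesgue (T i \<inter> ?J i) \<partial>count_space C)"
      by (simp add: nn_integral_cmult)
    also have "\<dots> \<le> (\<integral>\<^sup>+i. ennreal p * emeasure lebesgue (?J i) \<partial>count_space C)"
    proof (intro nn_integral_mono)
      fix i assume "i \<in> space (count_space C)"
      then have i: "(fst i, snd i) \<in> C" by simp
      have "ennreal q * emeasure lebesgue (T i \<inter> ?J i) \<le> ennreal q * emeasure lebesgue (T i)"
        using T(1) by (intro mult_left_mono emeasure_mono) auto
      also have "\<dots> \<le> ennreal (f (snd i) - f (fst i))" by (rule T(3))
      also have "\<dots> \<le> ennreal (p * (snd i - fst i))"
        using C(2)[OF i] by (intro ennreal_leI) (auto simp: field_simps)
      also have "\<dots> = ennreal p * emeasure lebesgue (?J i)"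
        using C(2)[OF i] pq by (simp add: ennreal_mult)
      finally show "ennreal q * emeasure lebesgue (T i \<inter> ?J i) \<le> ennreal p * emeasure lebesgue (?J i)" .
    qed
    also have "\<dots> = ennreal p * (\<integral>\<^sup>+i. emeasure lebesgue (?J i) \<partial>count_space C)"
      by (simp add: nn_integral_cmult)
    also have "(\<integral>\<^sup>+i. emeasure lebesgue (?J i) \<partial>count_space C) = emeasure lebesgue (\<Union>i\<in>C. ?J i)"
      using C(1) dis by (intro emeasure_UN_countable[symmetric]) auto
    also have "ennreal p * \<dots> \<le> ennreal p * emeasure lebesgue G"
    proof (intro mult_left_mono emeasure_mono UN_least)
      show "?J i \<subseteq> G" if "i \<in> C" for i
      proof -
        have "?J i \<subseteq> {fst i..snd i}" by auto
        also have "\<dots> \<subseteq> G" using C(2)[of "fst i" "snd i"] that by simp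
        finally show ?thesis .
      qed
    qed (use G(1) in auto)
    finally show ?thesis .
  qed
  obtain T where T: "T \<in> sets lebesgue" "?E \<subseteq> T" "m = emeasure lebesgue T"
    unfolding m_def using outer_measure_of_attain[of ?E lebesgue] by auto
  have "m \<le> outer_measure_of lebesgue {a<..<b}"
    unfolding m_def by (rule outer_measure_of_mono) auto
  then have m_fin: "m < \<infinity>"
    using fmeasurableD2[OF bounded_set_imp_lmeasurable[of "{a<..<b}"]]
    by (auto simp: order_le_less_trans less_top)
  obtain r where r: "m = ennreal r" "0 \<le> r" using m_fin by (cases m) auto
  have *: "q * r \<le> p * r + p * e" if e: "e > 0" for e
  proof -
    obtain G where G: "open G" "T \<subseteq> G" "G - T \<in> lmeasurable" "emeasure lebesgue (G - T) < ennreal e"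
      using sets_lebesgue_outer_open[OF T(1) e] .
    have "emeasure lebesgue G = emeasure lebesgue T + emeasure lebesgue (G - T)"
      using G(1,2) T(1) by (subst plus_emeasure) (auto simp: Un_absorb1)
    also have "\<dots> \<le> ennreal (r + e)"
      using G(4) r e T(3) by (simp add: add_left_mono)
    finally have "ennreal p * emeasure lebesgue G \<le> ennreal p * ennreal (r + e)"
      by (rule mult_left_mono) simp
    moreover have "ennreal q * m \<le> ennreal p * emeasure lebesgue G"
      using T(2) G(2) by (intro bound[OF G(1)]) (rule subset_trans)
    ultimately have "ennreal q * m \<le> ennreal p * ennreal (r + e)" by (rule order_trans[rotated])
    then have "ennreal (q * r) \<le> ennreal (p * (r + e))"
      using r pq e by (simp only: ennreal_mult)
    then have "q * r \<le> p * (r + e)"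
      using r pq e by (subst (asm) ennreal_le_iff) simp_all
    then show ?thesis by (simp add: algebra_simps)
  qed
  have "q * r \<le> p * r + e" if "0 < e" for e
    using *[of "e / p"] that pq by simp
  then have "q * r \<le> p * r" by (rule field_le_epsilon)
  then have "r = 0" using pq r(2) by (simp add: mult_le_cancel_right)
  then have "T \<in> null_sets lebesgue" using T r by auto
  then have "negligible T" by (simp add: negligible_iff_null_sets)
  then show ?thesis using T(2) by (rule negligible_subset)
qed

lemma unbounded_difference_quotient_negligible:
  fixes f :: "real \<Rightarrow> real"
  assumes f: "mono f"
  shows "negligible {x \<in> {a<..<b}. \<forall>n::nat. \<exists>\<^sub>F y in at x. real n < difference_quotient f x y}" (is "negligible ?E")
proof -
  define m where "m = outer_measure_of lebesgue ?E"
  obtain T where T: "T \<in> sets lebesgue" "?E \<subseteq> T" "m = emeasure lebesgue T"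
    unfolding m_def using outer_measure_of_attain[of ?E lebesgue] by auto
  have le: "ennreal (real n) * m \<le> ennreal (f b - f a)" if "n > 0" for n :: nat
  proof -
    obtain V where V: "V \<in> sets lebesgue" "?E \<subseteq> V" "ennreal (real n) * emeasure lebesgue V \<le> ennreal (f b - f a)"
    proof (rule steep_set_measure[OF f, of "real n" ?E a b])
      show "0 < real n" using \<open>n > 0\<close> by simp
    qed auto
    have "m \<le> outer_measure_of lebesgue V" unfolding m_def using V(2) by (rule outer_measure_of_mono)
    then have "ennreal (real n) * m \<le> ennreal (real n) * emeasure lebesgue V"
      using V(1) by (intro mult_left_mono) simp_all
    then show ?thesis using V(3) by (rule order_trans)
  qed
  have "m = 0"
  proof (rule ccontr)
    assume "m \<noteq> 0"
    have "m \<noteq> top" using le[of 1] by (auto simp: top_unique)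
    then obtain r where r: "m = ennreal r" "0 < r" using \<open>m \<noteq> 0\<close> by (cases m) (auto simp: less_le)
    obtain n :: nat where n: "(max 0 (f b - f a)) / r < real n" using reals_Archimedean2 by blast
    moreover have "0 < n" using n r by (cases n) (auto simp: divide_less_0_iff)
    ultimately have "real n * r \<le> max 0 (f b - f a)"
      using le[of n] r by (auto simp: ennreal_mult[symmetric] ennreal_le_iff2)
    with n r show False by (auto simp: field_simps)
  qed
  then have "T \<in> null_sets lebesgue" using T by auto
  then have "negligible T" by (simp add: negligible_iff_null_sets)
  then show ?thesis using T(2) by (rule negligible_subset)
qed

text \<open>
  Lebesgue's theorem. Off the null sets of the two preceding lemmas, for rational \<open>p\<close> and \<open>q\<close>, the
  difference quotient is bounded and does not oscillate; its limit is the supremum of the eventual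
  lower bounds.
\<close>

theorem mono_differentiable_ae:
  fixes f :: "real \<Rightarrow> real"
  assumes f: "mono f"
  shows "negligible {x. \<not> f differentiable (at x)}"
proof -
  define E where "E = (\<lambda>(n::nat, p::real, q::real). {x \<in> {-real n<..<real n}.
     (\<exists>\<^sub>F y in at x. difference_quotient f x y < p) \<and> (\<exists>\<^sub>F y in at x. q < difference_quotient f x y)})"
  define U where "U = (\<lambda>n::nat. {x \<in> {-real n<..<real n}. \<forall>k::nat. \<exists>\<^sub>F y in at x. real k < difference_quotient f x y})"
  define I where "I = {(n::nat, p, q). p \<in> \<rat> \<and> q \<in> \<rat> \<and> 0 < p \<and> p < (q::real)}"
  have "I \<subseteq> UNIV \<times> \<rat> \<times> \<rat>" by (auto simp: I_def)
  then have "countable I" by (rule countable_subset) (auto intro!: countable_SIGMA countable_rat)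
  then have "negligible (\<Union>i\<in>I. E i)"
  proof (intro negligible_countable_Union countable_image)
    fix A assume "A \<in> E ` I"
    then obtain n p q where "A = E (n, p, q)" "0 < p" "p < q" by (auto simp: I_def)
    then show "negligible A" using oscillating_difference_quotient_negligible[OF f] by (simp add: E_def)
  qed
  moreover have "negligible (\<Union>n. U n)"
    by (intro negligible_countable_Union) (use unbounded_difference_quotient_negligible[OF f] in \<open>auto simp only: U_def\<close>)
  moreover have "x \<in> (\<Union>i\<in>I. E i) \<union> (\<Union>n. U n)" if nd: "\<not> f differentiable (at x)" for x
  proof (rule ccontr)
    assume x: "\<not> ?thesis"
    obtain n :: nat where "\<bar>x\<bar> < real n" using reals_Archimedean2 by blast
    then have n: "x \<in> {-real n<..<real n}" by auto
    from x n obtain k where k: "\<forall>\<^sub>F y in at x. \<not> real k < difference_quotient f x y"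
      unfolding U_def not_frequently[symmetric] by blast
    have osc: "\<not> ((\<exists>\<^sub>F y in at x. difference_quotient f x y < p) \<and> (\<exists>\<^sub>F y in at x. q < difference_quotient f x y))"
      if "p \<in> \<rat>" "q \<in> \<rat>" "0 < p" "p < q" for p q
      using x n that by (auto simp: E_def I_def)
    define A where "A = {p. \<forall>\<^sub>F y in at x. p \<le> difference_quotient f x y}"
    have "0 \<le> difference_quotient f x y" for y
      unfolding difference_quotient_def using f
      by (cases "x \<le> y") (auto simp: monoD intro!: divide_nonneg_nonneg divide_nonpos_nonpos)
    then have A0: "0 \<in> A" by (simp add: A_def)
    have Ak: "p \<le> real k" if "p \<in> A" for p
    proof -
      have "\<forall>\<^sub>F y in at x. p \<le> difference_quotient f x y \<and> \<not> real k < difference_quotient f x y"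
        using that k by (auto simp: A_def eventually_conj_iff)
      then obtain y where "p \<le> difference_quotient f x y \<and> \<not> real k < difference_quotient f x y"
        using eventually_happens[of _ "at x"] by fastforce
      then show ?thesis by auto
    qed
    then have bdd: "bdd_above A" by (auto simp: bdd_above_def)
    define L where "L = Sup A"
    have "0 \<le> L" unfolding L_def by (rule cSup_upper[OF A0 bdd])
    have "(difference_quotient f x \<longlongrightarrow> L) (at x)"
    proof (rule order_tendstoI)
      fix l assume "l < L"
      then obtain p where "p \<in> A" "l < p" using less_cSup_iff[of A l] A0 bdd by (auto simp: L_def)
      then show "\<forall>\<^sub>F y in at x. l < difference_quotient f x y"
        by (auto simp: A_def elim: eventually_mono)
    next
      fix u assume "L < u"
      show "\<forall>\<^sub>F y in at x. difference_quotient f x y < u"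
      proof (rule ccontr)
        assume "\<not> ?thesis"
        then have fr: "\<exists>\<^sub>F y in at x. u \<le> difference_quotient f x y" by (simp add: frequently_def not_le)
        obtain q where q: "q \<in> \<rat>" "L < q" "q < u" using Rats_dense_in_real \<open>L < u\<close> by blast
        obtain p where p: "p \<in> \<rat>" "L < p" "p < q" using Rats_dense_in_real q by blast
        have "p \<notin> A" using cSup_upper[OF _ bdd, of p] p by (auto simp: L_def)
        then have "\<exists>\<^sub>F y in at x. difference_quotient f x y < p" by (simp add: A_def frequently_def not_less)
        moreover have "\<exists>\<^sub>F y in at x. q < difference_quotient f x y" using fr by (rule frequently_elim1) (use q in auto)
        ultimately show False using osc[of p q] p q \<open>0 \<le> L\<close> by auto
      qed
    qed
    then have "(f has_field_derivative L) (at x)"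
      unfolding has_field_derivative_iff difference_quotient_def .
    with nd show False using real_differentiable_def by blast
  qed
  ultimately show ?thesis by (metis (no_types, lifting) mem_Collect_eq negligible_Un negligible_subset subsetI)
qed

section \<open>Null sets of values\<close>

lemma absolutely_continuous_on_small_increments:
  assumes "absolutely_continuous_on S u" "0 < \<epsilon>"
  obtains \<delta> where "0 < \<delta>" "\<And>D. finite D \<Longrightarrow> (\<And>a b. (a, b) \<in> D \<Longrightarrow> a \<le> b \<and> {a..b} \<subseteq> S) \<Longrightarrow>
    disjoint_family_on (\<lambda>(a, b). {a<..<b}) D \<Longrightarrow> (\<Sum>(a, b)\<in>D. b - a) < \<delta> \<Longrightarrow>
    (\<Sum>(a, b)\<in>D. \<bar>u b - u a\<bar>) < \<epsilon>"
proof -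
  from assms obtain \<delta> where "0 < \<delta>" and \<delta>: "\<And>D. finite D \<Longrightarrow> (\<forall>(a, b)\<in>D. a \<le> b \<and> {a..b} \<subseteq> S) \<Longrightarrow>
    disjoint_family_on (\<lambda>(a, b). {a<..<b}) D \<Longrightarrow> (\<Sum>(a, b)\<in>D. b - a) < \<delta> \<Longrightarrow>
    (\<Sum>(a, b)\<in>D. \<bar>u b - u a\<bar>) < \<epsilon>"
    unfolding absolutely_continuous_on_def by meson
  show ?thesis
  proof (rule that[OF \<open>0 < \<delta>\<close>])
    show "(\<Sum>(a, b)\<in>D. \<bar>u b - u a\<bar>) < \<epsilon>" if "finite D" 
      "\<And>a b. (a, b) \<in> D \<Longrightarrow> a \<le> b \<and> {a..b} \<subseteq> S" "disjoint_family_on (\<lambda>(a, b). {a<..<b}) D"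
      "(\<Sum>(a, b)\<in>D. b - a) < \<delta>" for D
      by (rule \<delta>) (use that in auto)
  qed
qed

lemma absolutely_continuous_on_imp_continuous_on:
  assumes "absolutely_continuous_on {a..b} u"
  shows "continuous_on {a..b} u"
proof (rule continuous_onI)
  fix x e :: real assume x: "x \<in> {a..b}" and e: "0 < e"
  obtain \<delta> where \<delta>: "0 < \<delta>" "\<And>D. finite D \<Longrightarrow> (\<And>c d. (c, d) \<in> D \<Longrightarrow> c \<le> d \<and> {c..d} \<subseteq> {a..b}) \<Longrightarrow>
    disjoint_family_on (\<lambda>(c, d). {c<..<d}) D \<Longrightarrow> (\<Sum>(c, d)\<in>D. d - c) < \<delta> \<Longrightarrow>
    (\<Sum>(c, d)\<in>D. \<bar>u d - u c\<bar>) < e"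
    using absolutely_continuous_on_small_increments[OF assms e] by metis
  show "\<exists>d>0. \<forall>y\<in>{a..b}. dist y x < d \<longrightarrow> dist (u y) (u x) \<le> e"
  proof (intro exI[of _ \<delta>] conjI ballI impI \<delta>(1))
    fix y assume y: "y \<in> {a..b}" "dist y x < \<delta>"
    have "(\<Sum>(c, d)\<in>{(min x y, max x y)}. \<bar>u d - u c\<bar>) < e"
      by (rule \<delta>(2)) (use x y in \<open>auto simp: dist_real_def disjoint_family_on_def\<close>)
    then show "dist (u y) (u x) \<le> e"
      by (auto simp: dist_real_def min_def max_def split: if_splits)
  qed
qed

text \<open>
  Lusin's property (N). The null set lies in an open set of measure less than \<open>\<delta>\<close>, and this set contains
  nonoverlapping intervals that cover the null set. The image of each of them is the interval between the
  values at a minimum point \<open>\<alpha>\<close> and a maximum point \<open>\<beta>\<close>. The intervals between \<open>\<alpha>\<close> and \<open>\<beta>\<close> do not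
  overlap either, so the definition of absolute continuity bounds the total length of the images.
\<close>

theorem absolutely_continuous_on_negligible_image:
  assumes ac: "absolutely_continuous_on {a..b} u" and ab: "a < b"
    and N: "negligible N" "N \<subseteq> {a..b}"
  shows "negligible (u ` N)"
  unfolding negligible_outer_le
proof (intro allI impI)
  fix e :: real assume e: "0 < e"
  have cont: "continuous_on {a..b} u" by (rule absolutely_continuous_on_imp_continuous_on[OF ac])
  obtain \<delta> where \<delta>: "0 < \<delta>" "\<And>D. finite D \<Longrightarrow> (\<And>c d. (c, d) \<in> D \<Longrightarrow> c \<le> d \<and> {c..d} \<subseteq> {a..b}) \<Longrightarrow>
    disjoint_family_on (\<lambda>(c, d). {c<..<d}) D \<Longrightarrow> (\<Sum>(c, d)\<in>D. d - c) < \<delta> \<Longrightarrow>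
    (\<Sum>(c, d)\<in>D. \<bar>u d - u c\<bar>) < e"
    using absolutely_continuous_on_small_increments[OF ac e] by metis
  obtain G where G: "open G" "N \<subseteq> G" "G - N \<in> lmeasurable" "emeasure lebesgue (G - N) < ennreal \<delta>"
    using sets_lebesgue_outer_open[OF negligible_imp_sets[OF N(1)] \<delta>(1)] .
  have "emeasure lebesgue G = emeasure lebesgue (G - N)"
    using N(1) G(1) by (intro emeasure_Diff_null_set[symmetric]) (auto simp: negligible_iff_null_sets)
  then have Gm: "emeasure lebesgue G < ennreal \<delta>" using G(4) by simp
  define g where "g x = (if x \<in> G then G else UNIV)" for x
  have "gauge g" using G(1) by (auto simp: gauge_def g_def)
  moreover have "N \<subseteq> cbox a b" "box a b \<noteq> {}" using N ab by auto
  ultimately obtain \<D> where \<D>: "countable \<D>" "\<Union>\<D> \<subseteq> cbox a b"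
      "\<And>K. K \<in> \<D> \<Longrightarrow> interior K \<noteq> {} \<and> (\<exists>c d. K = cbox c d)"
      "pairwise (\<lambda>A B. interior A \<inter> interior B = {}) \<D>"
      "\<And>K. K \<in> \<D> \<Longrightarrow> \<exists>x \<in> N \<inter> K. K \<subseteq> g x" "N \<subseteq> \<Union>\<D>"
    using covering_lemma[of N a b g] by metis
  have "\<exists>c d \<alpha> \<beta>. c < d \<and> K = {c..d} \<and> {c..d} \<subseteq> {a..b} \<and> {c..d} \<subseteq> G \<and> \<alpha> \<in> {c..d} \<and> \<beta> \<in> {c..d} \<and>
      (\<forall>y\<in>{c..d}. u \<alpha> \<le> u y \<and> u y \<le> u \<beta>)" if K: "K \<in> \<D>" for K
  proof -
    obtain c d where cd: "K = {c..d}" "interior K \<noteq> {}" using \<D>(3)[OF K] by auto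
    then have "c < d" by auto
    have sub: "{c..d} \<subseteq> {a..b}" using \<D>(2) K unfolding cd(1) cbox_interval by blast
    have "K \<subseteq> G" using \<D>(5)[OF K] G(2) by (auto simp: g_def split: if_splits)
    have "continuous_on {c..d} u" using cont sub continuous_on_subset by blast
    moreover have "compact {c..d}" "{c..d} \<noteq> {}" using \<open>c < d\<close> by auto
    ultimately obtain \<alpha> \<beta> where "\<alpha> \<in> {c..d}" "\<forall>y\<in>{c..d}. u \<alpha> \<le> u y" "\<beta> \<in> {c..d}" "\<forall>y\<in>{c..d}. u y \<le> u \<beta>"
      using continuous_attains_inf continuous_attains_sup by metis
    then show ?thesis using \<open>c < d\<close> sub \<open>K \<subseteq> G\<close> cd(1) by blast
  qed
  then obtain c d \<alpha> \<beta> where K: "\<And>K. K \<in> \<D> \<Longrightarrow> c K < d K \<and> K = {c K..d K} \<and> {c K..d K} \<subseteq> {a..b}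
      \<and> {c K..d K} \<subseteq> G \<and> \<alpha> K \<in> {c K..d K} \<and> \<beta> K \<in> {c K..d K} \<and>
      (\<forall>y\<in>{c K..d K}. u (\<alpha> K) \<le> u y \<and> u y \<le> u (\<beta> K))"
    by metis
  let ?J = "\<lambda>K. {u (\<alpha> K)..u (\<beta> K)}"
  have le: "u (\<alpha> K) \<le> u (\<beta> K)" if "K \<in> \<D>" for K using K[OF that] by blast
  have dis: "disjoint_family_on (\<lambda>K. {c K<..<d K}) \<D>"
    unfolding disjoint_family_on_def
  proof (intro ballI impI)
    fix A B assume AB: "A \<in> \<D>" "B \<in> \<D>" "A \<noteq> B"
    then have "interior A \<inter> interior B = {}" using \<D>(4) by (auto simp: pairwise_def)
    moreover have "interior A = {c A<..<d A}" "interior B = {c B<..<d B}"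
      using K[OF AB(1)] K[OF AB(2)] interior_atLeastAtMost_real by metis+
    ultimately show "{c A<..<d A} \<inter> {c B<..<d B} = {}" by simp
  qed
  have bound: "measure lebesgue (\<Union>K\<in>F. ?J K) \<le> e" if F: "F \<subseteq> \<D>" "finite F" for F
  proof -
    define m where "m K = (min (\<alpha> K) (\<beta> K), max (\<alpha> K) (\<beta> K))" for K
    have m: "{fst (m K)<..<snd (m K)} \<subseteq> {c K<..<d K}" "{fst (m K)..snd (m K)} \<subseteq> {c K..d K}"
        "fst (m K) \<le> snd (m K)" "snd (m K) - fst (m K) \<le> d K - c K"
        "\<bar>u (snd (m K)) - u (fst (m K))\<bar> = u (\<beta> K) - u (\<alpha> K)" if "K \<in> F" for K
      using K[of K] le[of K] that F(1) by (auto simp: m_def min_def max_def split: if_splits)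
    \<comment> \<open>Distinct covering intervals may share an end point and then lead to the same pair, but only to a
      degenerate one, which contributes nothing to the sums.\<close>
    have nontriv: "fst (m A) = snd (m A)" if "A \<in> F" "B \<in> F" "A \<noteq> B" "m A = m B" for A B
    proof -
      have "{c A<..<d A} \<inter> {c B<..<d B} = {}" using disjoint_family_onD[OF dis] that F(1) by blast
      then have "{fst (m A)<..<snd (m A)} = {}" using m(1)[OF that(1)] m(1)[OF that(2), folded that(4)] by blast
      then show ?thesis using m(3)[OF that(1)] by (simp add: less_le)
    qed
    have "(\<Sum>(s, t)\<in>m ` F. t - s) = (\<Sum>K\<in>F. snd (m K) - fst (m K))"
      by (subst sum.reindex_nontrivial[OF F(2)]) (auto simp: nontriv case_prod_beta)
    also have "\<dots> \<le> (\<Sum>K\<in>F. measure lebesgue {c K<..<d K})"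
      using m(4) K F(1) by (intro sum_mono) (auto simp: less_imp_le subset_eq)
    also have "\<dots> = measure lebesgue (\<Union>K\<in>F. {c K<..<d K})"
      using F dis by (intro measure_UNION'[symmetric])
        (auto simp: disjoint_family_on_def pairwise_def disjnt_def subset_eq)
    also have "\<dots> \<le> measure lebesgue G"
    proof (rule measure_mono_fmeasurable)
      show "(\<Union>K\<in>F. {c K<..<d K}) \<subseteq> G"
        using K F(1) by (meson UN_least greaterThanLessThan_subseteq_atLeastAtMost_iff order_refl subset_trans subsetD)
      show "G \<in> lmeasurable" using G(1) Gm by (intro fmeasurableI) (auto intro: order_less_trans)
    qed (auto intro!: sets.finite_UN F)
    also have "\<dots> < \<delta>" using Gm \<delta>(1) by (cases "emeasure lebesgue G") (auto simp: measure_def ennreal_less_iff)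
    finally have small: "(\<Sum>(s, t)\<in>m ` F. t - s) < \<delta>" .
    have "(\<Sum>(s, t)\<in>m ` F. \<bar>u t - u s\<bar>) < e"
    proof (rule \<delta>(2)[OF _ _ _ small])
      show "s \<le> t \<and> {s..t} \<subseteq> {a..b}" if st: "(s, t) \<in> m ` F" for s t
      proof -
        obtain K' where K': "K' \<in> F" "m K' = (s, t)" using st by auto
        then have "s \<le> t" "{s..t} \<subseteq> {c K'..d K'}" using m(2,3)[OF K'(1)] by auto
        moreover have "{c K'..d K'} \<subseteq> {a..b}" using K[of K'] K'(1) F(1) by blast
        ultimately show ?thesis by blast
      qed
      show "disjoint_family_on (\<lambda>(s, t). {s<..<t}) (m ` F)"
        unfolding disjoint_family_on_def
      proof (intro ballI impI)
        fix i j assume "i \<in> m ` F" "j \<in> m ` F" "i \<noteq> j"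
        then obtain A B where AB: "A \<in> F" "B \<in> F" "i = m A" "j = m B" "A \<noteq> B" by blast
        have "{c A<..<d A} \<inter> {c B<..<d B} = {}" using disjoint_family_onD[OF dis] AB F(1) by blast
        then show "(case i of (s, t) \<Rightarrow> {s<..<t}) \<inter> (case j of (s, t) \<Rightarrow> {s<..<t}) = {}"
          unfolding AB(3,4) case_prod_beta using m(1)[OF AB(1)] m(1)[OF AB(2)] by blast
      qed
    qed (use F in auto)
    moreover have "(\<Sum>(s, t)\<in>m ` F. \<bar>u t - u s\<bar>) = (\<Sum>K\<in>F. u (\<beta> K) - u (\<alpha> K))"
      by (subst sum.reindex_nontrivial[OF F(2)]) (auto simp: nontriv m(5) case_prod_beta)
    moreover have "measure lebesgue (\<Union>K\<in>F. ?J K) \<le> (\<Sum>K\<in>F. measure lebesgue (?J K))"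
      by (intro measure_UNION_le F) auto
    moreover have "(\<Sum>K\<in>F. measure lebesgue (?J K)) = (\<Sum>K\<in>F. u (\<beta> K) - u (\<alpha> K))"
      using le F(1) by (intro sum.cong) auto
    ultimately show ?thesis by linarith
  qed
  have "u ` N \<subseteq> (\<Union>K\<in>\<D>. ?J K)"
  proof
    fix z assume "z \<in> u ` N"
    then obtain x K' where x: "z = u x" "x \<in> K'" "K' \<in> \<D>" using \<D>(6) by blast
    then have "z \<in> ?J K'" using K[OF x(3)] by auto
    then show "z \<in> (\<Union>K\<in>\<D>. ?J K)" using x(3) by blast
  qed
  moreover have "(\<Union>K\<in>\<D>. ?J K) \<in> lmeasurable" "measure lebesgue (\<Union>K\<in>\<D>. ?J K) \<le> e"
    by (rule fmeasurable_UN_bound[OF \<D>(1)], use bound in auto)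
      (rule measure_UN_bound[OF \<D>(1)], use bound in auto)
  ultimately show "\<exists>T. u ` N \<subseteq> T \<and> T \<in> lmeasurable \<and> measure lebesgue T \<le> e" by blast
qed

text \<open>
  The one-dimensional case of Sard's theorem, transferred from \<^typ>\<open>real^1\<close>.
\<close>

theorem critical_values_negligible:
  fixes u :: "real \<Rightarrow> real"
  assumes "\<And>x. x \<in> C \<Longrightarrow> (u has_real_derivative 0) (at x)"
  shows "negligible (u ` C)"
proof -
  let ?v = "\<lambda>x::real^1. vec (u (x $ 1)) :: real^1"
  have "(?v has_derivative (*\<^sub>R) 0) (at x within vec ` C)" if x: "x \<in> vec ` C" for x
  proof -
    obtain y where y: "x = vec y" "y \<in> C" using x by blast
    have "(u has_derivative (\<lambda>h. h * 0)) (at y within C)"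
      using has_field_derivative_at_within[OF assms[OF y(2)]]
      by (simp add: has_field_derivative_def lambda_zero)
    from has_derivative_vector_1[where g' = "\<lambda>_. 0", OF this] show ?thesis by (simp add: y(1))
  qed
  then have "negligible (?v ` vec ` C)"
    by (rule baby_Sard[rotated]) (auto simp: matrix_def rank_0 scaleR_zero_left simp flip: zero_vec_def)
  then have "negligible ((\<lambda>x. x $ 1) ` ?v ` vec ` C)"
    by (rule negligible_differentiable_image_negligible[rotated])
      (auto intro!: linear_imp_differentiable_on bounded_linear.linear bounded_linear_vec_nth)
  then show ?thesis by (simp add: image_image)
qed

section \<open>The convexity inequality for two slopes\<close>

text \<open>
  The kernel whose joint convexity is the hypothesis of the main theorem: the perspective
  \<open>s F(1/s)\<close> of the integrand \<open>F(q) = (1 + q\<^sup>2) powr (p x / 2)\<close>. It is the energy of a piece of the graph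
  per unit of height, as a function of the inverse slope \<open>s\<close>.
\<close>

definition perspective :: "(real \<Rightarrow> real) \<Rightarrow> real \<Rightarrow> real \<Rightarrow> real" where
  "perspective p s x = s * (1 + s powi (-2)) powr (p x / 2)"

definition excess :: "(real \<Rightarrow> real) \<Rightarrow> real \<Rightarrow> real \<Rightarrow> real" where
  "excess p x q = (1 + \<bar>q\<bar>\<^sup>2) powr (p x / 2) - 1"

lemma excess_0 [simp]: "excess p x 0 = 0"
  by (simp add: excess_def)

lemma excess_nonneg: "0 \<le> p x \<Longrightarrow> 0 \<le> excess p x q"
  by (simp add: excess_def ge_one_powr_ge_zero)

lemma perspective_eq_excess:
  assumes "0 < a" "0 < q"
  shows "q * perspective p (a / q) x = a * (1 + excess p x (q / a))"
  using assms by (simp add: perspective_def excess_def power_int_def power_divide field_simps)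

text \<open>
  For \<open>z = 1/s\<^sup>2\<close> the left-hand side is the derivative of \<open>s (1 + 1/s\<^sup>2) powr c\<close> with respect to \<open>s\<close>.
  In terms of \<open>y = z / (1 + z)\<close> the bound follows from Bernoulli's inequality if \<open>c \<ge> 1\<close>, and from
  \<open>1 - y \<le> (1 - y) powr c\<close> otherwise.
\<close>

lemma powr_one_plus_bernoulli:
  fixes z c :: real
  assumes "0 \<le> z" "1 \<le> 2 * c"
  shows "(1 + z) powr c * (1 - 2 * c * z / (1 + z)) \<le> 1"
proof -
  define y where "y = z / (1 + z)"
  have y: "0 \<le> y" "y < 1" "1 - y = 1 / (1 + z)" using assms by (auto simp: y_def field_simps)
  have "1 - 2 * c * y \<le> (1 - y) powr c"
  proof (cases "1 \<le> c")
    case True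
    \<comment> \<open>Young's inequality with weights \<open>1 / c\<close> and \<open>1 - 1 / c\<close> gives Bernoulli's inequality.\<close>
    then have "((1 - y) powr c) powr (1 / c) * 1 powr (1 - 1 / c) \<le> 1 / c * (1 - y) powr c + (1 - 1 / c) * 1"
      using y by (intro Youngs_inequality_0) auto
    then have "1 - y \<le> 1 / c * (1 - y) powr c + (1 - 1 / c)"
      using True y(1,2) by (simp add: powr_powr)
    then have "c * (1 - y) \<le> c * (1 / c * (1 - y) powr c + (1 - 1 / c))"
      using True by (intro mult_left_mono) auto
    then have "1 - c * y \<le> (1 - y) powr c"
      using True by (simp add: algebra_simps)
    moreover have "c * y \<le> 2 * c * y" using True y by (simp add: mult_right_mono)
    ultimately show ?thesis by linarith
  next
    case False
    have "1 - y \<le> (1 - y) powr c"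
      using powr_mono'[of c 1 "1 - y"] False y(1,2) by simp
    moreover have "y \<le> 2 * c * y" using assms y mult_right_mono[of 1 "2 * c" y] by simp
    ultimately show ?thesis by linarith
  qed
  also have "(1 - y) powr c = 1 / (1 + z) powr c"
    using assms by (simp add: y(3) powr_divide)
  finally show ?thesis
    using assms by (simp add: y_def field_simps)
qed

lemma perspective_slope_le_1:
  assumes p: "1 \<le> p x" and s: "0 < s" "0 \<le> d"
  shows "perspective p (s + d) x \<le> perspective p s x + d"
proof -
  define c where "c = p x / 2"
  define k where "k t = t * (1 + 1 / t\<^sup>2) powr c" for t :: real
  have "k (s + d) - (s + d) \<le> k s - s"
  proof (rule DERIV_nonpos_imp_nonincreasing[where f = "\<lambda>t. k t - t"])
    fix t assume "s \<le> t" "t \<le> s + d"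
    then have t: "0 < t" using s by simp
    define B where "B = 1 + 1 / t\<^sup>2"
    have B: "0 < B" unfolding B_def using t by (simp add: add_pos_pos)
    have "((\<lambda>t. 1 + 1 / t\<^sup>2) has_real_derivative - 2 / t ^ 3) (at t)"
      using t by (auto intro!: derivative_eq_intros simp: field_simps eval_nat_numeral)
    then have "((\<lambda>t. (1 + 1 / t\<^sup>2) powr c) has_real_derivative c * B powr (c - 1) * (- 2 / t ^ 3)) (at t)"
      using DERIV_fun_powr[where r = c] B by (fastforce simp: B_def)
    then have "((\<lambda>t. k t - t) has_real_derivative
        t * (c * B powr (c - 1) * (- 2 / t ^ 3)) + 1 * B powr c - 1) (at t)"
      using DERIV_diff[OF DERIV_mult[OF DERIV_ident] DERIV_ident]
      by (fastforce simp: k_def B_def algebra_simps)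
    moreover have "t * (c * B powr (c - 1) * (- 2 / t ^ 3)) + 1 * B powr c - 1
        = B powr c * (1 - 2 * c * (1 / t\<^sup>2) / B) - 1"
      using t B by (simp add: powr_diff field_simps eval_nat_numeral)
    moreover have "B powr c * (1 - 2 * c * (1 / t\<^sup>2) / B) \<le> 1"
      using powr_one_plus_bernoulli[of "1 / t\<^sup>2" c] p by (simp add: B_def c_def)
    ultimately show "\<exists>y. ((\<lambda>t. k t - t) has_real_derivative y) (at t) \<and> y \<le> 0"
      by (metis diff_le_0_iff_le)
  qed (use s in simp)
  then show ?thesis by (simp add: perspective_def k_def c_def power_int_def field_simps)
qed

context
  fixes p :: "real \<Rightarrow> real"
  assumes p_ge: "\<forall>x\<in>{-1..1}. p x \<ge> 1"
    and p_even: "\<forall>x\<in>{-1..1}. p (- x) = p x"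
    and convex: "convex_on ({0<..} \<times> {-1..1}) (\<lambda>(s, x). s * (1 + s powi (-2)) powr (p x / 2))"
begin

lemma perspective_convex:
  assumes "0 < s" "0 < t" "x \<in> {-1..1}" "y \<in> {-1..1}" "0 \<le> \<alpha>" "0 \<le> \<beta>" "\<alpha> + \<beta> = 1"
  shows "perspective p (\<alpha> * s + \<beta> * t) (\<alpha> * x + \<beta> * y) \<le> \<alpha> * perspective p s x + \<beta> * perspective p t y"
proof -
  let ?k = "\<lambda>(s, x). s * (1 + s powi (-2)) powr (p x / 2)"
  have "?k (\<alpha> *\<^sub>R (s, x) + \<beta> *\<^sub>R (t, y)) \<le> \<alpha> * ?k (s, x) + \<beta> * ?k (t, y)"
    using convex assms unfolding convex_on_def by blast
  then show ?thesis by (simp add: perspective_def)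
qed

lemma perspective_even:
  assumes "x \<in> {-1..1}"
  shows "perspective p s (- x) = perspective p s x"
  using p_even assms by (simp add: perspective_def)

text \<open>
  The point \<open>x\<close> is a convex combination of \<open>y\<close> and \<open>-y\<close>, where the kernel has the same value.
\<close>

lemma perspective_mono_abs:
  assumes "0 < s" "0 \<le> x" "x \<le> y" "y \<le> 1"
  shows "perspective p s x \<le> perspective p s y"
proof (cases "y = 0")
  case False
  then have y: "0 < y" using assms by simp
  define \<alpha> where "\<alpha> = (1 + x / y) / 2"
  have "0 \<le> x / y" "x / y \<le> 1" using assms y by auto
  then have "perspective p (\<alpha> * s + (1 - \<alpha>) * s) (\<alpha> * y + (1 - \<alpha>) * (- y))
      \<le> \<alpha> * perspective p s y + (1 - \<alpha>) * perspective p s (- y)"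
    using assms by (intro perspective_convex) (auto simp: \<alpha>_def)
  moreover have "\<alpha> * s + (1 - \<alpha>) * s = s" by (simp add: algebra_simps)
  moreover have "\<alpha> * y + (1 - \<alpha>) * (- y) = x" using y by (simp add: \<alpha>_def field_simps)
  ultimately show ?thesis using perspective_even[of y s] assms by (simp add: algebra_simps)
qed (use assms in auto)

text \<open>
  The pointwise inequality behind the theorem. In its application \<open>q\<close> is the modulus of the slope of the
  symmetrization at \<open>x\<close>, while \<open>y\<close> and \<open>z\<close> are the outermost points where the function has the same value. The inverse slopes \<open>a / q\<close> and
  \<open>b / q\<close> need not add up to \<open>2 / q\<close>. The deficit \<open>d\<close> is added to the first one, at a cost of at most \<open>d\<close>.
  The midpoint of \<open>(a / q + d, -y)\<close> and \<open>(b / q, z)\<close> is then \<open>(1 / q, (z - y) / 2)\<close>.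
\<close>

lemma excess_two_branches:
  assumes q: "0 < q" and ab: "0 < a" "0 < b" "a + b \<le> 2"
    and yz: "-1 \<le> y" "z \<le> 1" "2 * x \<le> z - y" and x: "0 \<le> x"
  shows "2 * excess p x q \<le> a * excess p y (q / a) + b * excess p z (q / b)"
proof -
  have yz': "y \<in> {-1..1}" "z \<in> {-1..1}" "(z - y) / 2 \<le> 1" using yz x by auto
  define d where "d = (2 - a - b) / q"
  have d: "0 \<le> d" using ab q by (simp add: d_def)
  have "perspective p (1 / q) x \<le> perspective p (1 / q) ((z - y) / 2)"
    using perspective_mono_abs[of "1 / q" x "(z - y) / 2"] q x yz yz' by simp
  moreover have "perspective p (1 / q) ((z - y) / 2)
      \<le> 1 / 2 * perspective p (a / q + d) (- y) + 1 / 2 * perspective p (b / q) z"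
  proof -
    have s: "1 / 2 * (a / q + d) + 1 / 2 * (b / q) = 1 / q"
      using q by (simp add: d_def field_simps)
    have m: "1 / 2 * (- y) + 1 / 2 * z = (z - y) / 2" by (simp add: field_simps)
    have "perspective p (1 / 2 * (a / q + d) + 1 / 2 * (b / q)) (1 / 2 * (- y) + 1 / 2 * z)
      \<le> 1 / 2 * perspective p (a / q + d) (- y) + 1 / 2 * perspective p (b / q) z"
      using q ab d yz' by (intro perspective_convex) (auto simp: add_pos_nonneg)
    then show ?thesis unfolding s m .
  qed
  moreover have "perspective p (a / q + d) (- y) \<le> perspective p (a / q) y + d"
    using perspective_slope_le_1[of p y "a / q" d] perspective_even[OF yz'(1)] p_ge yz' q ab d by auto
  ultimately have "2 * perspective p (1 / q) x \<le> perspective p (a / q) y + perspective p (b / q) z + d"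
    by linarith
  then have "2 * (q * perspective p (1 / q) x) \<le> q * perspective p (a / q) y + q * perspective p (b / q) z + q * d"
    using q mult_left_mono[of _ _ q] by (fastforce simp: algebra_simps)
  then have "2 * (1 + excess p x q)
      \<le> a * (1 + excess p y (q / a)) + b * (1 + excess p z (q / b)) + (2 - a - b)"
    using perspective_eq_excess[of 1 q p x] perspective_eq_excess[of a q p y] perspective_eq_excess[of b q p z] q ab
    by (simp add: d_def)
  then show ?thesis by (simp add: algebra_simps)
qed
end

section \<open>The first and the last point where a level is reached\<close>

definition first_reach :: "(real \<Rightarrow> real) \<Rightarrow> real \<Rightarrow> real" where
  "first_reach u t = Inf {x \<in> {-1..1}. t \<le> u x}"

text \<open>
  Defined by reflection, so that its properties are those of \<open>first_reach\<close>.
\<close>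

definition last_reach :: "(real \<Rightarrow> real) \<Rightarrow> real \<Rightarrow> real" where
  "last_reach u t = - first_reach (\<lambda>x. u (- x)) t"

lemma first_reach_props:
  assumes u: "continuous_on {-1..1} u" "u (-1) = 0" and t: "0 < t" "t \<le> u x" "x \<in> {-1..1}"
  shows "-1 < first_reach u t" "first_reach u t \<le> x" "u (first_reach u t) = t"
    and "\<And>y. -1 \<le> y \<Longrightarrow> y < first_reach u t \<Longrightarrow> u y < t"
proof -
  let ?S = "{x \<in> {-1..1}. t \<le> u x}" and ?f = "first_reach u t"
  have cl: "closed ?S"
  proof -
    have "closed ({-1..1} \<inter> u -` {t..})" by (rule continuous_closed_preimage[OF u(1)]) auto
    moreover have "{-1..1} \<inter> u -` {t..} = ?S" by auto
    ultimately show ?thesis by simp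
  qed
  have ne: "?S \<noteq> {}" and bd: "bdd_below ?S" using t by (auto intro: bdd_belowI[of _ "-1"])
  have f: "?f \<in> ?S" unfolding first_reach_def by (rule closed_contains_Inf[OF ne bd cl])
  show low: "u y < t" if "-1 \<le> y" "y < ?f" for y
  proof (rule ccontr)
    assume "\<not> ?thesis"
    then have "y \<in> ?S" using that f by auto
    then have "?f \<le> y" unfolding first_reach_def using bd by (rule cInf_lower)
    with that show False by simp
  qed
  show "?f \<le> x" unfolding first_reach_def using t bd by (intro cInf_lower) auto
  show f1: "-1 < ?f" using f u(2) t(1) by (cases "?f = -1") auto
  have "\<exists>y\<ge>-1. y \<le> ?f \<and> u y = t"
    using f u t f1 by (intro IVT') (auto intro: continuous_on_subset)
  then obtain y where "-1 \<le> y" "y \<le> ?f" "u y = t" by blast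
  with low[of y] show "u ?f = t" by (cases "y = ?f") auto
qed

text \<open>
  Where the first point that reaches \<open>t\<close> is not critical, \<open>u\<close> exceeds \<open>t\<close> immediately to the right of
  it, while it stays away from \<open>t\<close> further to the left. So \<open>first_reach u\<close>, in general only a
  monotone right inverse of \<open>u\<close> with jumps, is continuous at \<open>t\<close>, and the rule for the derivative of an
  inverse function applies.
\<close>

lemma first_reach_deriv:
  assumes u: "continuous_on {-1..1} u" "u (-1) = 0" and t: "0 < t" "t \<le> u x" "x \<in> {-1..1}"
    and in1: "first_reach u t < 1"
    and D: "(u has_real_derivative D) (at (first_reach u t))" "D \<noteq> 0"
  shows "0 < D" "(first_reach u has_real_derivative inverse D) (at t)"
    "\<forall>\<^sub>F y in at_right (first_reach u t). t < u y"
proof -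
  let ?f = "first_reach u"
  note f = first_reach_props[OF u t]
  show D0: "0 < D"
  proof (rule ccontr)
    assume "\<not> 0 < D"
    then obtain d where d: "d > 0" "\<forall>h>0. h < d \<longrightarrow> u (?f t) < u (?f t - h)"
      using DERIV_neg_dec_left[OF D(1)] D(2) by auto
    define h where "h = min (d / 2) (?f t + 1)"
    have "0 < h" "h < d" "-1 \<le> ?f t - h" using d(1) f(1) by (auto simp: h_def)
    then have "u (?f t) < u (?f t - h)" "u (?f t - h) < t" using d(2) f(4)[of "?f t - h"] by auto
    with f(3) show False by simp
  qed
  obtain d where d: "d > 0" "\<And>h. 0 < h \<Longrightarrow> h < d \<Longrightarrow> u (?f t) < u (?f t + h)"
    using DERIV_pos_inc_right[OF D(1) D0] by auto
  have right: "t < u y" if "?f t < y" "y < ?f t + d" for y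
    using d(2)[of "y - ?f t"] that f(3) by simp
  show "\<forall>\<^sub>F y in at_right (?f t). t < u y"
    using d(1) by (intro eventually_mono[OF eventually_at_right_real[of "?f t" "?f t + d"]]) (auto simp: right)
  have cont: "isCont ?f t"
    unfolding continuous_at_eps_delta
  proof (intro allI impI)
    fix e :: real assume e: "0 < e"
    define y where "y = ?f t + min (e / 2) (min (d / 2) ((1 - ?f t) / 2))"
    have y: "?f t < y" "y < ?f t + e" "y < ?f t + d" "y \<in> {-1..1}"
      using e d(1) in1 f(1) by (auto simp: y_def min_def field_simps)
    \<comment> \<open>Levels above the maximum of \<open>u\<close> on the interval from \<open>-1\<close> to \<open>z\<close> are first reached to the right of \<open>z\<close>.\<close>
    define z where "z = max (-1) (?f t - e / 2)"
    have z: "-1 \<le> z" "?f t - e < z" "z < ?f t" "z \<le> 1" using e f(1) in1 by (auto simp: z_def)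
    have "continuous_on {-1..z} u"
      using z u(1) by (auto intro: continuous_on_subset)
    then obtain m where m: "m \<in> {-1..z}" "\<And>x. x \<in> {-1..z} \<Longrightarrow> u x \<le> u m"
      using continuous_attains_sup[of "{-1..z}" u] z(1) by auto
    have um: "u m < t" using f(4)[of m] m(1) z by auto
    define \<delta> where "\<delta> = min (t - max 0 (u m)) (u y - t)"
    have "0 < \<delta>" using t um right[OF y(1,3)] by (auto simp: \<delta>_def)
    moreover have "\<bar>?f s - ?f t\<bar> < e" if s: "\<bar>s - t\<bar> < \<delta>" for s
    proof -
      have s': "0 < s" "u m < s" "s \<le> u y" using s by (auto simp: \<delta>_def)
      note g = first_reach_props[OF u s'(1,3) y(4)]
      have "z < ?f s"
      proof (rule ccontr)
        assume "\<not> ?thesis"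
        then have "u (?f s) \<le> u m" using g(1) by (intro m(2)) auto
        with g(3) s'(2) show False by simp
      qed
      then show ?thesis using g(2) y z by auto
    qed
    ultimately show "\<exists>\<delta>>0. \<forall>x'. dist x' t < \<delta> \<longrightarrow> dist (?f x') (?f t) < e"
      by (auto simp: dist_real_def)
  qed
  define y where "y = ?f t + min (d / 2) ((1 - ?f t) / 2)"
  have y: "?f t < y" "y < ?f t + d" "y \<in> {-1..1}"
    using d(1) in1 f(1) by (auto simp: y_def min_def field_simps)
  show "(?f has_real_derivative inverse D) (at t)"
  proof (rule DERIV_inverse_function[where f = u and g = ?f and x = t and a = 0 and b = "u y", OF D])
    show "0 < t" "t < u y" using t right y by auto
    show "u (?f s) = s" if "0 < s" "s < u y" for s
      using first_reach_props(3)[OF u that(1) _ y(3)] that by simp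
  qed (fact cont)
qed

lemma last_reach_props:
  assumes u: "continuous_on {-1..1} u" "u 1 = 0" and t: "0 < t" "t \<le> u x" "x \<in> {-1..1}"
  shows "last_reach u t < 1" "x \<le> last_reach u t" "u (last_reach u t) = t"
    and "\<And>y. y \<le> 1 \<Longrightarrow> last_reach u t < y \<Longrightarrow> u y < t"
proof -
  have c: "continuous_on {-1..1} (\<lambda>x. u (- x))"
    by (rule continuous_on_compose2[OF u(1)]) (auto intro!: continuous_intros)
  note f = first_reach_props[of "\<lambda>x. u (- x)" t "- x", OF c]
  show "last_reach u t < 1" "x \<le> last_reach u t" "u (last_reach u t) = t"
    using f(1-3) u(2) t by (auto simp: last_reach_def)
  show "u y < t" if "y \<le> 1" "last_reach u t < y" for y
    using f(4)[of "- y"] that u(2) t by (auto simp: last_reach_def)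
qed

lemma last_reach_deriv:
  assumes u: "continuous_on {-1..1} u" "u 1 = 0" and t: "0 < t" "t \<le> u x" "x \<in> {-1..1}"
    and in1: "-1 < last_reach u t"
    and D: "(u has_real_derivative D) (at (last_reach u t))" "D \<noteq> 0"
  shows "D < 0" "(last_reach u has_real_derivative inverse D) (at t)"
    "\<forall>\<^sub>F y in at_left (last_reach u t). t < u y"
proof -
  let ?v = "\<lambda>x. u (- x)"
  have c: "continuous_on {-1..1} ?v"
    by (rule continuous_on_compose2[OF u(1)]) (auto intro!: continuous_intros)
  have D': "(?v has_real_derivative - D) (at (first_reach ?v t))"
    using D(1) DERIV_mirror[of u D "first_reach ?v t"] by (simp add: last_reach_def)
  note * = first_reach_deriv[OF c _ t(1), of "- x" "- D", OF _ _ _ _ D']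
  show "D < 0" using * u t in1 D by (auto simp: last_reach_def)
  have "(first_reach ?v has_real_derivative inverse (- D)) (at t)"
    using *(2) u t in1 D by (auto simp: last_reach_def)
  then show "(last_reach u has_real_derivative inverse D) (at t)"
    unfolding last_reach_def[abs_def] using DERIV_minus by fastforce
  have "\<forall>\<^sub>F y in at_right (first_reach ?v t). t < ?v y"
    using *(3) u t in1 D by (auto simp: last_reach_def)
  then show "\<forall>\<^sub>F y in at_left (last_reach u t). t < u y"
    unfolding last_reach_def eventually_at_left_to_right by simp
qed

section \<open>The symmetrization and its superlevel sets\<close>

text \<open>
  The levels \<open>t\<close> whose symmetrized superlevel set contains \<open>x\<close>. They form an interval starting at \<open>0\<close>,
  and the symmetrization is its length; this makes the symmetrization a generalized inverse of
  the measure of the superlevel sets.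
\<close>

definition passed_levels :: "(real \<Rightarrow> real) \<Rightarrow> real \<Rightarrow> real set" where
  "passed_levels u x = {t. 0 \<le> t \<and> superlevel u t \<noteq> {} \<and> 2 * \<bar>x\<bar> \<le> measure lebesgue (superlevel u t)}"

lemma symmetrization_eq_measure:
  "symmetrization u x = measure lebesgue (passed_levels u x)"
proof -
  have "indicator {0..} t *\<^sub>R indicator (symmetrized_set (superlevel u t)) x
      = (indicator (passed_levels u x) t :: real)" for t
    by (auto simp: indicator_def passed_levels_def symmetrized_set_def abs_le_iff)
  then show ?thesis
    by (simp add: symmetrization_def set_lebesgue_integral_def)
qed

lemma superlevel_lmeasurable:
  assumes "continuous_on {-1..1} u"
  shows "superlevel u t \<in> lmeasurable"
proof -
  have "{-1..1} - ({-1..1} \<inter> u -` {..t}) \<in> lmeasurable"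
  proof (rule fmeasurable.Diff)
    have "closed ({-1..1} \<inter> u -` {..t})" by (rule continuous_closed_preimage[OF assms]) auto
    then show "{-1..1} \<inter> u -` {..t} \<in> lmeasurable"
      by (intro lmeasurable_compact) (meson bounded_Int bounded_closed_interval compact_eq_bounded_closed)
  qed simp
  moreover have "{-1..1} - ({-1..1} \<inter> u -` {..t}) = superlevel u t" by (auto simp: superlevel_def)
  ultimately show ?thesis by simp
qed

lemma superlevel_antimono: "s \<le> t \<Longrightarrow> superlevel u t \<subseteq> superlevel u s"
  by (auto simp: superlevel_def)

lemma measure_disjoint_Un:
  assumes "A \<in> fmeasurable M" "B \<in> fmeasurable M" "A \<inter> B = {}"
  shows "measure M (A \<union> B) = measure M A + measure M B"
  using assms by (intro measure_Union) (auto dest: fmeasurableD2)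

lemma
  fixes S :: "nat \<Rightarrow> 'a set"
  assumes "\<And>n. S n \<in> fmeasurable M" "incseq S" "\<And>n. measure M (S n) \<le> b"
  shows fmeasurable_incseq_Union: "(\<Union>n. S n) \<in> fmeasurable M"
    and measure_incseq_Union_le: "measure M (\<Union>n. S n) \<le> b"
proof -
  have "measure M (\<Union>i\<le>n. S i) \<le> b" for n
  proof -
    have "(\<Union>i\<le>n. S i) = S n" using assms(2) by (auto dest: incseqD)
    then show ?thesis using assms(3) by simp
  qed
  then show "(\<Union>n. S n) \<in> fmeasurable M" "measure M (\<Union>n. S n) \<le> b"
    using fmeasurable_countable_Union measure_countable_Union_le assms(1) by blast+
qed

context
  fixes u :: "real \<Rightarrow> real"
  assumes cont: "continuous_on {-1..1} u"
begin

lemma passed_levels_downward: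
  assumes "t \<in> passed_levels u x" "0 \<le> s" "s \<le> t"
  shows "s \<in> passed_levels u x"
proof -
  have "measure lebesgue (superlevel u t) \<le> measure lebesgue (superlevel u s)"
    using superlevel_antimono[OF assms(3)] superlevel_lmeasurable[OF cont]
    by (intro measure_mono_fmeasurable) auto
  then show ?thesis using assms superlevel_antimono[OF assms(3), of u] by (auto simp: passed_levels_def)
qed

lemma passed_levels_lmeasurable: "passed_levels u x \<in> lmeasurable"
proof -
  have "compact (u ` {-1..1})" using cont by (intro compact_continuous_image) auto
  then obtain B where B: "\<And>y. y \<in> {-1..1} \<Longrightarrow> \<bar>u y\<bar> \<le> B"
    using compact_imp_bounded bounded_iff by (metis imageI real_norm_def)
  have "passed_levels u x \<subseteq> {0..B}"
  proof
    fix t assume "t \<in> passed_levels u x"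
    then obtain y where "0 \<le> t" "y \<in> {-1..1}" "t < u y" by (auto simp: passed_levels_def superlevel_def)
    with B[of y] show "t \<in> {0..B}" by auto
  qed
  then have "bounded (passed_levels u x)" using bounded_closed_interval bounded_subset by blast
  moreover have "convex (passed_levels u x)"
    unfolding is_interval_convex_1[symmetric] is_interval_1
  proof (intro allI impI ballI)
    fix a b y assume "a \<in> passed_levels u x" "b \<in> passed_levels u x" "a \<le> y \<and> y \<le> b"
    then show "y \<in> passed_levels u x"
      using passed_levels_downward[of b x y] by (auto simp: passed_levels_def)
  qed
  ultimately show ?thesis by (intro measurable_convex)
qed

lemma symmetrization_nonneg: "0 \<le> symmetrization u x"
  by (simp add: symmetrization_eq_measure)

lemma level_below_symmetrization:
  assumes "0 \<le> t" "t < symmetrization u x"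
  shows "t \<in> passed_levels u x"
proof (rule ccontr)
  assume "\<not> ?thesis"
  then have "passed_levels u x \<subseteq> {0..t}"
    using passed_levels_downward[of _ x t] assms(1) by (force simp: passed_levels_def)
  then have "measure lebesgue (passed_levels u x) \<le> measure lebesgue {0..t}"
    using passed_levels_lmeasurable by (intro measure_mono_fmeasurable) auto
  with assms show False by (simp add: symmetrization_eq_measure)
qed

lemma level_le_symmetrization:
  assumes "t \<in> passed_levels u x"
  shows "t \<le> symmetrization u x"
proof -
  have "{0..t} \<subseteq> passed_levels u x" using passed_levels_downward[OF assms] by auto
  then have "measure lebesgue {0..t} \<le> measure lebesgue (passed_levels u x)"
    using passed_levels_lmeasurable by (intro measure_mono_fmeasurable) auto
  moreover have "0 \<le> t" using assms by (simp add: passed_levels_def)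
  ultimately show ?thesis by (simp add: symmetrization_eq_measure)
qed

lemma symmetrization_even: "symmetrization u (- x) = symmetrization u x"
  by (simp add: symmetrization_eq_measure passed_levels_def)

lemma symmetrization_antimono:
  assumes "\<bar>x\<bar> \<le> \<bar>y\<bar>"
  shows "symmetrization u y \<le> symmetrization u x"
proof -
  have "passed_levels u y \<subseteq> passed_levels u x" using assms by (auto simp: passed_levels_def)
  then show ?thesis
    unfolding symmetrization_eq_measure using passed_levels_lmeasurable
    by (intro measure_mono_fmeasurable) auto
qed

text \<open>
  Besides evenness and monotonicity, this lemma and \<open>measure_from_symmetrization\<close> are all that the
  comparison of energies uses about the values of the symmetrization. Both are limits, from above and from below, of the fact that levels below the
  symmetrization are passed and levels above are not.
\<close>

lemma measure_above_symmetrization: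
  "measure lebesgue (superlevel u (symmetrization u x)) \<le> 2 * \<bar>x\<bar>"
proof -
  let ?w = "symmetrization u x"
  let ?S = "\<lambda>n. superlevel u (?w + 1 / real (Suc n))"
  have "superlevel u ?w = (\<Union>n. ?S n)"
  proof
    show "superlevel u ?w \<subseteq> (\<Union>n. ?S n)"
    proof
      fix y assume y: "y \<in> superlevel u ?w"
      then have "0 < u y - ?w" by (simp add: superlevel_def)
      then obtain n where "1 / real (Suc n) < u y - ?w" using nat_approx_posE by blast
      with y show "y \<in> (\<Union>n. ?S n)" by (auto simp: superlevel_def intro!: exI[of _ n])
    qed
    show "(\<Union>n. ?S n) \<subseteq> superlevel u ?w"
      by (intro UN_least superlevel_antimono) simp
  qed
  moreover have "measure lebesgue (\<Union>n. ?S n) \<le> 2 * \<bar>x\<bar>"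
  proof (rule measure_incseq_Union_le)
    show "incseq ?S"
      by (intro incseq_SucI superlevel_antimono) (simp add: frac_le)
    show "measure lebesgue (?S n) \<le> 2 * \<bar>x\<bar>" for n
    proof (cases "?S n = {}")
      case False
      have "?w + 1 / real (Suc n) \<notin> passed_levels u x"
        using level_le_symmetrization[of "?w + 1 / real (Suc n)" x] by auto
      then show ?thesis using False symmetrization_nonneg[of x] by (auto simp: passed_levels_def)
    qed simp
  qed (rule superlevel_lmeasurable[OF cont])
  ultimately show ?thesis by simp
qed

lemma measure_from_symmetrization:
  assumes nonneg: "\<forall>y\<in>{-1..1}. 0 \<le> u y" and x: "0 \<le> x" "x \<le> 1"
  shows "2 * x \<le> measure lebesgue {y \<in> {-1..1}. symmetrization u x \<le> u y}"
proof (cases "symmetrization u x = 0")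
  case True
  then have "{y \<in> {-1..1}. symmetrization u x \<le> u y} = {-1..1}" using nonneg by auto
  then show ?thesis using x by simp
next
  case False
  let ?w = "symmetrization u x"
  have w: "0 < ?w" using False symmetrization_nonneg[of x] by simp
  let ?S = "\<lambda>n. {-1..1} - superlevel u (?w - ?w / real (Suc n))"
  have meas: "measure lebesgue ({-1..1} - superlevel u t) = 2 - measure lebesgue (superlevel u t)" for t
    using superlevel_lmeasurable[OF cont, of t]
    by (subst measurable_measure_Diff) (auto simp: superlevel_def)
  have eq: "{y \<in> {-1..1}. ?w \<le> u y} = {-1..1} - (\<Union>n. ?S n)"
  proof (rule set_eqI, rule iffI)
    fix y assume "y \<in> {y \<in> {-1..1}. ?w \<le> u y}"
    then have y: "y \<in> {-1..1}" "?w \<le> u y" by auto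
    have "?w - ?w / real (Suc n) < u y" for n
    proof -
      have "0 < ?w / real (Suc n)" using w by (intro divide_pos_pos) auto
      with y(2) show ?thesis by linarith
    qed
    with y(1) show "y \<in> {-1..1} - (\<Union>n. ?S n)" unfolding superlevel_def by blast
  next
    fix y assume y: "y \<in> {-1..1} - (\<Union>n. ?S n)"
    have "?w \<le> u y"
    proof (rule ccontr)
      assume "\<not> ?thesis"
      then have "0 < (?w - u y) / ?w" using w by simp
      then obtain n where "1 / real (Suc n) < (?w - u y) / ?w" using nat_approx_posE by blast
      then have "u y < ?w - ?w / real (Suc n)" using w by (simp add: field_simps)
      moreover have "y \<in> superlevel u (?w - ?w / real (Suc n))" using y by blast
      ultimately show False by (simp add: superlevel_def)
    qed
    with y show "y \<in> {y \<in> {-1..1}. ?w \<le> u y}" by blast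
  qed
  have Sm: "?S n \<in> lmeasurable" for n
    using superlevel_lmeasurable[OF cont] by (intro fmeasurable.Diff) auto
  have inc: "incseq ?S"
    using w by (intro incseq_SucI Diff_mono superlevel_antimono) (simp_all add: frac_le)
  have le: "measure lebesgue (?S n) \<le> 2 - 2 * x" for n
  proof -
    have "?w / real (Suc n) \<le> ?w" using w by (simp add: field_simps)
    then have "?w - ?w / real (Suc n) \<in> passed_levels u x"
      using w by (intro level_below_symmetrization) auto
    then show ?thesis using x by (simp add: meas passed_levels_def)
  qed
  have "(\<Union>n. ?S n) \<in> lmeasurable" "measure lebesgue (\<Union>n. ?S n) \<le> 2 - 2 * x"
    using fmeasurable_incseq_Union[OF Sm inc le] measure_incseq_Union_le[OF Sm inc le] by auto
  then show ?thesis
    unfolding eq by (subst measurable_measure_Diff) auto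
qed
end

section \<open>The two outer branches over a point\<close>

lemma symmetrization_deriv_neg:
  assumes "continuous_on {-1..1} u" "0 < x"
    and W: "(symmetrization u has_real_derivative W) (at x)" "W \<noteq> 0"
  shows "W < 0"
proof (rule ccontr)
  assume "\<not> W < 0"
  then obtain d where d: "d > 0" "\<forall>h>0. h < d \<longrightarrow> symmetrization u x < symmetrization u (x + h)"
    using DERIV_pos_inc_right[OF W(1)] W(2) by auto
  have "symmetrization u x < symmetrization u (x + d / 2)" using d by simp
  moreover have "symmetrization u (x + d / 2) \<le> symmetrization u x"
    using assms d by (intro symmetrization_antimono) auto
  ultimately show False by simp
qed

lemma symmetrization_inj_on:
  assumes "continuous_on {-1..1} u" and B: "\<And>x. x \<in> B \<Longrightarrow> 0 < x"
    and W: "\<And>x. x \<in> B \<Longrightarrow> (symmetrization u has_real_derivative W x) (at x) \<and> W x \<noteq> 0"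
  shows "inj_on (symmetrization u) B"
proof (rule linorder_inj_onI')
  fix x y assume xy: "x \<in> B" "y \<in> B" "x < y"
  have "W x < 0" using symmetrization_deriv_neg[OF assms(1) B] W xy(1) by blast
  then obtain d where d: "d > 0" "\<forall>h>0. h < d \<longrightarrow> symmetrization u (x + h) < symmetrization u x"
    using DERIV_neg_dec_right W[OF xy(1)] by blast
  define h where "h = min (d / 2) (y - x)"
  have h: "0 < h" "h < d" "x + h \<le> y" using d(1) xy by (auto simp: h_def)
  have "symmetrization u y \<le> symmetrization u (x + h)"
    using h B[OF xy(1)] by (intro symmetrization_antimono[OF assms(1)]) auto
  then show "symmetrization u x \<noteq> symmetrization u y" using d(2) h by force
qed

definition left_branch :: "(real \<Rightarrow> real) \<Rightarrow> real \<Rightarrow> real" where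
  "left_branch u x = first_reach u (symmetrization u x)"

definition right_branch :: "(real \<Rightarrow> real) \<Rightarrow> real \<Rightarrow> real" where
  "right_branch u x = last_reach u (symmetrization u x)"

context
  fixes u :: "real \<Rightarrow> real"
  assumes cont: "continuous_on {-1..1} u" and left: "u (-1) = 0" and right: "u 1 = 0"
    and nonneg: "\<forall>y\<in>{-1..1}. 0 \<le> u y"
begin

lemma branch_level:
  assumes x: "0 < x" "x \<le> 1" and w: "0 < symmetrization u x"
  shows "-1 < left_branch u x" "right_branch u x < 1"
    "u (left_branch u x) = symmetrization u x" "u (right_branch u x) = symmetrization u x"
    "{y \<in> {-1..1}. symmetrization u x \<le> u y} \<subseteq> {left_branch u x..right_branch u x}"
    "2 * x \<le> right_branch u x - left_branch u x"
    "\<exists>y\<in>{-1..1}. symmetrization u x \<le> u y"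
proof -
  let ?A = "{y \<in> {-1..1}. symmetrization u x \<le> u y}"
  have m: "2 * x \<le> measure lebesgue ?A"
    by (rule measure_from_symmetrization[OF cont nonneg less_imp_le[OF x(1)] x(2)])
  have "?A \<noteq> {}"
  proof
    assume "?A = {}"
    from m[unfolded this] x show False by simp
  qed
  then obtain y where y: "symmetrization u x \<le> u y" "y \<in> {-1..1}" by blast
  note L = first_reach_props[OF cont left w y, folded left_branch_def]
  note R = last_reach_props[OF cont right w y, folded right_branch_def]
  show "-1 < left_branch u x" "right_branch u x < 1"
    "u (left_branch u x) = symmetrization u x" "u (right_branch u x) = symmetrization u x"
    by (fact L R)+
  show sub: "?A \<subseteq> {left_branch u x..right_branch u x}"
  proof
    fix z assume z: "z \<in> ?A"
    have "\<not> z < left_branch u x" using L(4)[of z] z by auto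
    moreover have "\<not> right_branch u x < z" using R(4)[of z] z by auto
    ultimately show "z \<in> {left_branch u x..right_branch u x}" by simp
  qed
  have "closed ({-1..1} \<inter> u -` {symmetrization u x..})"
    by (rule continuous_closed_preimage[OF cont]) auto
  moreover have "{-1..1} \<inter> u -` {symmetrization u x..} = ?A" by auto
  ultimately have "measure lebesgue ?A \<le> measure lebesgue {left_branch u x..right_branch u x}"
    using sub by (intro measure_mono_fmeasurable) auto
  also have "\<dots> = right_branch u x - left_branch u x"
    using L(2) R(2) by (simp add: measure_def)
  finally show "2 * x \<le> right_branch u x - left_branch u x" by (rule order_trans[OF m])
  show "\<exists>y\<in>{-1..1}. symmetrization u x \<le> u y" using y by blast
qed

text \<open>
  The superlevel set at the lower level \<open>w x\<close> contains the one at \<open>w y\<close> and, at both ends, the intervals by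
  which the branches move. Its measure is at most \<open>2 x\<close>, whereas the set at the higher level has at least
  the measure \<open>2 y\<close>. Dividing by \<open>x - y\<close> gives the bound for the derivatives of the branches.
\<close>

lemma branch_increments_le:
  assumes x: "0 < x" "x \<le> 1" "0 < symmetrization u x"
    and y: "0 < y" "y < x" "symmetrization u x < symmetrization u y"
    and L: "left_branch u x < left_branch u y" "\<And>z. left_branch u x < z \<Longrightarrow> z < left_branch u y \<Longrightarrow> symmetrization u x < u z"
    and R: "right_branch u y < right_branch u x" "\<And>z. right_branch u y < z \<Longrightarrow> z < right_branch u x \<Longrightarrow> symmetrization u x < u z"
  shows "(left_branch u y - left_branch u x) + (right_branch u x - right_branch u y) \<le> 2 * (x - y)"
proof -
  let ?l = "left_branch u" and ?r = "right_branch u"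
  let ?A1 = "{?l x<..<?l y}" and ?A2 = "{?r y<..<?r x}" and ?A3 = "{z \<in> {-1..1}. symmetrization u y \<le> u z}"
  have y1: "0 < y" "y \<le> 1" "0 < symmetrization u y" using x y by auto
  note bx = branch_level[OF x] and by' = branch_level[OF y1]
  have ry: "?l y < ?r y" using by'(6) y1 by linarith
  have "closed ({-1..1} \<inter> u -` {symmetrization u y..})"
    by (rule continuous_closed_preimage[OF cont]) auto
  moreover have "{-1..1} \<inter> u -` {symmetrization u y..} = ?A3" by auto
  ultimately have m3: "?A3 \<in> lmeasurable"
    by (intro lmeasurable_compact) (metis bounded_Int bounded_closed_interval compact_eq_bounded_closed)
  have m12: "?A1 \<in> lmeasurable" "?A2 \<in> lmeasurable" by auto
  have dis: "(?A1 \<union> ?A2) \<inter> ?A3 = {}" "?A1 \<inter> ?A2 = {}" using by'(5) ry by fastforce+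
  have "measure lebesgue (?A1 \<union> ?A2 \<union> ?A3) = measure lebesgue (?A1 \<union> ?A2) + measure lebesgue ?A3"
    by (rule measure_disjoint_Un[OF fmeasurable.Un[OF m12] m3 dis(1)])
  also have "measure lebesgue (?A1 \<union> ?A2) = measure lebesgue ?A1 + measure lebesgue ?A2"
    by (rule measure_disjoint_Un[OF m12 dis(2)])
  also have "measure lebesgue ?A1 = ?l y - ?l x" using L(1) by simp
  also have "measure lebesgue ?A2 = ?r x - ?r y" using R(1) by simp
  finally have "(?l y - ?l x) + (?r x - ?r y) + measure lebesgue ?A3
    = measure lebesgue (?A1 \<union> ?A2 \<union> ?A3)" by (rule sym)
  also have "\<dots> \<le> measure lebesgue (superlevel u (symmetrization u x))"
  proof (rule measure_mono_fmeasurable)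
    have "?A1 \<union> ?A2 \<subseteq> {-1..1}" using bx(1,2) by'(1,2) ry by auto
    moreover have "?A1 \<subseteq> {z. symmetrization u x < u z}" "?A2 \<subseteq> {z. symmetrization u x < u z}"
      using L(2) R(2) by auto
    moreover have "?A3 \<subseteq> {z. symmetrization u x < u z}" using y(3) by auto
    ultimately show "?A1 \<union> ?A2 \<union> ?A3 \<subseteq> superlevel u (symmetrization u x)"
      unfolding superlevel_def by blast
    show "?A1 \<union> ?A2 \<union> ?A3 \<in> sets lebesgue" using m3 by auto
  qed (rule superlevel_lmeasurable[OF cont])
  also have "\<dots> \<le> 2 * x"
    using measure_above_symmetrization[OF cont, of x] x(1) by simp
  finally have "(?l y - ?l x) + (?r x - ?r y) + measure lebesgue ?A3 \<le> 2 * x" .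
  moreover have "2 * y \<le> measure lebesgue ?A3"
    by (rule measure_from_symmetrization[OF cont nonneg less_imp_le[OF y1(1)] y1(2)])
  ultimately have "(?l y - ?l x) + (?r x - ?r y) + 2 * y \<le> 2 * x"
    by (rule order_trans[OF add_left_mono, rotated])
  then show ?thesis by (simp add: algebra_simps)
qed

text \<open>
  The derivatives come from the chain rule for \<open>first_reach u\<close> and \<open>last_reach u\<close> after the
  symmetrization; \<open>a + b \<le> 2\<close> is the infinitesimal form of \<open>branch_increments_le\<close>.
\<close>

lemma branch_derivs:
  assumes x: "0 < x" "x \<le> 1" and w: "0 < symmetrization u x"
    and W: "(symmetrization u has_real_derivative W) (at x)" "W \<noteq> 0"
    and regular: "\<And>y. y \<in> {-1<..<1} \<Longrightarrow> u y = symmetrization u x \<Longrightarrow> \<exists>D. (u has_real_derivative D) (at y) \<and> D \<noteq> 0"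
  obtains a b where "0 < a" "0 < b" "a + b \<le> 2"
    "(left_branch u has_real_derivative - a) (at x)" "(right_branch u has_real_derivative b) (at x)"
    "deriv u (left_branch u x) = - W / a" "deriv u (right_branch u x) = W / b"
proof -
  let ?l = "left_branch u" and ?r = "right_branch u" and ?w = "symmetrization u"
  note b = branch_level[OF x w]
  have lr: "?l x < ?r x" using b(6) x by linarith
  have W0: "W < 0" by (rule symmetrization_deriv_neg[OF cont x(1) W])
  obtain y0 where y0: "?w x \<le> u y0" "y0 \<in> {-1..1}" using b(7) by blast
  obtain D where D: "(u has_real_derivative D) (at (?l x))" "D \<noteq> 0"
    using regular[of "?l x"] b(1,2,3) lr by auto
  obtain E where E: "(u has_real_derivative E) (at (?r x))" "E \<noteq> 0"
    using regular[of "?r x"] b(1,2,4) lr by auto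
  have "first_reach u (?w x) < 1" "-1 < last_reach u (?w x)"
    using b(1,2) lr by (auto simp: left_branch_def right_branch_def)
  note L = first_reach_deriv[OF cont left w y0 this(1) D[unfolded left_branch_def]]
    and R = last_reach_deriv[OF cont right w y0 this(2) E[unfolded right_branch_def]]
  define a where "a = - W / D"
  define b where "b = W / E"
  have ab: "0 < a" "0 < b" using W0 L(1) R(1) by (auto simp: a_def b_def divide_neg_neg divide_neg_pos)
  have l': "(?l has_real_derivative - a) (at x)"
    using DERIV_chain2[OF L(2) W(1)] unfolding left_branch_def[abs_def] a_def by (simp add: divide_inverse mult.commute)
  have r': "(?r has_real_derivative b) (at x)"
    using DERIV_chain2[OF R(2) W(1)] unfolding right_branch_def[abs_def] b_def by (simp add: divide_inverse mult.commute)
  have "a + b \<le> 2"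
  proof (rule ccontr)
    assume "\<not> ?thesis"
    \<comment> \<open>Otherwise \<open>2 y + l y - r y\<close> would decrease at \<open>x\<close>, but by \<open>branch_increments_le\<close> its values slightly to
      the left of \<open>x\<close> do not exceed the value at \<open>x\<close>.\<close>
    then have "2 + - a - b < 0" by simp
    moreover have "((\<lambda>y. 2 * y + ?l y - ?r y) has_real_derivative 2 + - a - b) (at x)"
      by (auto intro!: derivative_eq_intros l' r')
    ultimately obtain d0 where d0: "d0 > 0" "\<forall>h>0. h < d0 \<longrightarrow>
        2 * x + ?l x - ?r x < 2 * (x - h) + ?l (x - h) - ?r (x - h)"
      using DERIV_neg_dec_left by blast
    obtain d1 where d1: "d1 > 0" "\<forall>h>0. h < d1 \<longrightarrow> ?w x < ?w (x - h)"
      using DERIV_neg_dec_left[OF W(1) W0] by blast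
    obtain d2 where d2: "d2 > 0" "\<forall>h>0. h < d2 \<longrightarrow> ?l x < ?l (x - h)"
      using DERIV_neg_dec_left[OF l'] ab by auto
    obtain d3 where d3: "d3 > 0" "\<forall>h>0. h < d3 \<longrightarrow> ?r (x - h) < ?r x"
      using DERIV_pos_inc_left[OF r'] ab by auto
    obtain z1 where z1: "?l x < z1" "\<And>z. ?l x < z \<Longrightarrow> z < z1 \<Longrightarrow> ?w x < u z"
      using L(3) unfolding left_branch_def[symmetric] eventually_at_right_field by blast
    obtain z2 where z2: "z2 < ?r x" "\<And>z. z2 < z \<Longrightarrow> z < ?r x \<Longrightarrow> ?w x < u z"
      using R(3) unfolding right_branch_def[symmetric] eventually_at_left_field by blast
    have "\<forall>\<^sub>F y in at x. ?l y < z1"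
      using DERIV_isCont[OF l'] z1(1) unfolding isCont_def by (rule order_tendstoD)
    moreover have "\<forall>\<^sub>F y in at x. z2 < ?r y"
      using DERIV_isCont[OF r'] z2(1) unfolding isCont_def by (rule order_tendstoD)
    ultimately have "\<forall>\<^sub>F y in at x. ?l y < z1 \<and> z2 < ?r y" by (rule eventually_conj)
    then obtain d4 where d4: "d4 > 0" "\<And>y. y \<noteq> x \<Longrightarrow> dist y x < d4 \<Longrightarrow> ?l y < z1 \<and> z2 < ?r y"
      unfolding eventually_at by auto
    define m where "m = min d0 (min d1 (min d2 (min d3 (min d4 x))))"
    have "0 < m" using d0(1) d1(1) d2(1) d3(1) d4(1) x by (simp add: m_def)
    moreover have "m \<le> d0" "m \<le> d1" "m \<le> d2" "m \<le> d3" "m \<le> d4" "m \<le> x"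
      unfolding m_def by linarith+
    moreover define h where "h = m / 2"
    ultimately have h: "0 < h" "h < d0" "h < d1" "h < d2" "h < d3" "h < d4" "h < x"
      by linarith+
    have "?l (x - h) < z1 \<and> z2 < ?r (x - h)"
      using h by (intro d4(2)) (auto simp: dist_real_def)
    then have "(?l (x - h) - ?l x) + (?r x - ?r (x - h)) \<le> 2 * (x - (x - h))"
      using h x w d1(2) d2(2) d3(2) by (intro branch_increments_le z1(2) z2(2)) auto
    with d0(2) h show False by fastforce
  qed
  moreover have "deriv u (?l x) = - W / a" "deriv u (?r x) = W / b"
    using D E W0 by (auto simp: a_def b_def DERIV_imp_deriv)
  ultimately show ?thesis using that ab l' r' by blast
qed
end

section \<open>Regular points and comparison of the energies\<close>

lemma symmetrization_differentiable_ae: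
  assumes cont: "continuous_on {-1..1} u"
  shows "negligible {x. \<not> symmetrization u differentiable (at x)}"
proof -
  let ?w = "symmetrization u"
  define f where "f x = - ?w (max 0 x)" for x
  let ?N = "{x. \<not> f differentiable (at x)}"
  have "mono f"
    unfolding f_def by (intro monoI) (auto intro!: symmetrization_antimono[OF cont])
  then have N: "negligible ?N" by (rule mono_differentiable_ae)
  have pos: "?w differentiable (at x)" if "0 < x" "x \<notin> ?N" for x
  proof -
    obtain D where "(f has_real_derivative D) (at x)" using \<open>x \<notin> ?N\<close> real_differentiable_def by blast
    then have "((\<lambda>x. - f x) has_real_derivative - D) (at x)" by (rule DERIV_minus)
    then have "(?w has_real_derivative - D) (at x)"
      by (rule DERIV_cong_ev[THEN iffD1, rotated 3])
        (use \<open>0 < x\<close> in \<open>auto simp: f_def eventually_nhds intro!: exI[of _ "{0<..}"]\<close>)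
    then show ?thesis using real_differentiable_def by blast
  qed
  have neg: "?w differentiable (at x)" if "x < 0" "- x \<notin> ?N" for x
  proof -
    have "?w differentiable (at (- x))" using pos[of "- x"] that by simp
    then obtain D where "(?w has_real_derivative D) (at (- x))"
      using real_differentiable_def by blast
    then have "((\<lambda>y. ?w (- y)) has_real_derivative - D) (at x)" by (simp add: DERIV_mirror)
    then show ?thesis unfolding symmetrization_even[OF cont] using real_differentiable_def by blast
  qed
  have "{x. \<not> ?w differentiable (at x)} \<subseteq> ?N \<union> uminus ` ?N \<union> {0}"
  proof
    fix x assume x: "x \<in> {x. \<not> ?w differentiable (at x)}"
    consider "x = 0" | "0 < x" | "x < 0" by linarith
    then show "x \<in> ?N \<union> uminus ` ?N \<union> {0}"
    proof cases
      case 3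
      then have "- x \<in> ?N" using neg x by blast
      then show ?thesis by force
    qed (use pos x in auto)
  qed
  moreover have "negligible (uminus ` ?N)"
    by (rule negligible_differentiable_image_negligible[OF _ N]) (auto intro: derivative_intros)
  ultimately show ?thesis using N by (meson negligible_Un negligible_sing negligible_subset)
qed

lemma nn_integral_lebesgue_reflect:
  fixes g :: "real \<Rightarrow> ennreal"
  assumes "g \<in> borel_measurable lebesgue"
  shows "(\<integral>\<^sup>+x. g (- x) \<partial>lebesgue) = (\<integral>\<^sup>+x. g x \<partial>lebesgue)"
proof -
  have m: "uminus \<in> lebesgue \<rightarrow>\<^sub>M (lebesgue :: real measure)"
    using lebesgue_measurable_scaling[of "-1"] by (simp add: scaleR_minus1_left[abs_def])
  have "lebesgue = distr lebesgue lebesgue (uminus :: real \<Rightarrow> real)"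
    using lebesgue_real_scale[of "-1"] by (simp add: density_1)
  then have "(\<integral>\<^sup>+x. g x \<partial>lebesgue) = (\<integral>\<^sup>+x. g x \<partial>distr lebesgue lebesgue uminus)" by simp
  also have "\<dots> = (\<integral>\<^sup>+x. g (- x) \<partial>lebesgue)"
    using assms by (intro nn_integral_distr m) simp
  finally show ?thesis by simp
qed

lemma excess_measurable:
  assumes "continuous_on {-1..1} p" "dv \<in> borel_measurable (lebesgue_on {-1..1})"
  shows "(\<lambda>x. excess p x (dv x)) \<in> borel_measurable (lebesgue_on {-1..1})"
proof -
  have [measurable]: "p \<in> borel_measurable (lebesgue_on {-1..1})"
    using assms(1) by (rule continuous_imp_measurable_on_sets_lebesgue) simp
  note assms(2)[measurable]
  show ?thesis unfolding excess_def by measurable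
qed

lemma energy_eq_excess:
  assumes p: "continuous_on {-1..1} p" "\<forall>x\<in>{-1..1}. p x \<ge> 1"
    and dv: "dv \<in> borel_measurable (lebesgue_on {-1..1})"
    and ae: "AE x in lebesgue_on {-1..1}. deriv v x = dv x"
  shows "energy p v = 2 + (\<integral>\<^sup>+x. ennreal (excess p x (dv x)) \<partial>lebesgue_on {-1..1})"
proof -
  note [measurable] = excess_measurable[OF p(1) dv]
  have "energy p v = (\<integral>\<^sup>+x. ennreal ((1 + \<bar>deriv v x\<bar>\<^sup>2) powr (p x / 2)) \<partial>lebesgue_on {-1..1})"
    unfolding energy_def by (subst nn_integral_restrict_space) auto
  also have "\<dots> = (\<integral>\<^sup>+x. 1 + ennreal (excess p x (dv x)) \<partial>lebesgue_on {-1..1})"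
  proof (rule nn_integral_cong_AE, rule AE_mp[OF ae], rule AE_I2, rule impI)
    fix x assume x: "x \<in> space (lebesgue_on {-1..1::real})" and eq: "deriv v x = dv x"
    have "1 \<le> p x" using p(2) x by simp
    then have "0 \<le> excess p x (dv x)" by (intro excess_nonneg) simp
    then have "1 + ennreal (excess p x (dv x)) = ennreal (1 + excess p x (dv x))"
      by (simp add: ennreal_plus flip: ennreal_1)
    then show "ennreal ((1 + \<bar>deriv v x\<bar>\<^sup>2) powr (p x / 2)) = 1 + ennreal (excess p x (dv x))"
      by (simp add: eq excess_def)
  qed
  also have "\<dots> = (\<integral>\<^sup>+x. 1 \<partial>lebesgue_on {-1..1::real}) + (\<integral>\<^sup>+x. ennreal (excess p x (dv x)) \<partial>lebesgue_on {-1..1})"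
    by (rule nn_integral_add) auto
  also have "(\<integral>\<^sup>+x. 1 \<partial>lebesgue_on {-1..1::real}) = 2"
    by (simp add: emeasure_restrict_space)
  finally show ?thesis .
qed

text \<open>
  Change of variables along a branch. The image of \<open>S\<close> is measurable, being a differentiable image, and
  therefore inherits the integrability of \<open>f\<close> from \<open>A\<close>.
\<close>

lemma absolutely_integrable_branch:
  fixes f g :: "real \<Rightarrow> real"
  assumes f: "f absolutely_integrable_on A" and S: "S \<in> sets lebesgue"
    and g: "\<And>x. x \<in> S \<Longrightarrow> (g has_real_derivative g' x) (at x)" "inj_on g S" "g ` S \<subseteq> A"
  shows "(\<lambda>x. \<bar>g' x\<bar> * f (g x)) absolutely_integrable_on S"
    "integral S (\<lambda>x. \<bar>g' x\<bar> * f (g x)) = integral (g ` S) f"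
    "f absolutely_integrable_on g ` S"
proof -
  have gS: "g ` S \<in> sets lebesgue"
  proof (rule differentiable_image_in_sets_lebesgue[OF S])
    show "g differentiable_on S"
      using g(1) by (meson differentiable_at_imp_differentiable_on real_differentiable_def)
  qed simp
  show i: "f absolutely_integrable_on g ` S"
    by (rule set_integrable_subset[OF f gS g(3)])
  have d: "(g has_field_derivative g' x) (at x within S)" if "x \<in> S" for x
    by (rule has_field_derivative_at_within[OF g(1)[OF that]])
  show "(\<lambda>x. \<bar>g' x\<bar> * f (g x)) absolutely_integrable_on S"
    "integral S (\<lambda>x. \<bar>g' x\<bar> * f (g x)) = integral (g ` S) f"
    using has_absolute_integral_change_of_variables_1'[OF S d g(2), of f "integral (g ` S) f"] i by auto
qed

text \<open>
  The points in the right half of the interval over which both branches are differentiable.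
\<close>

definition regular_points :: "(real \<Rightarrow> real) \<Rightarrow> real set" where
  "regular_points u = {x \<in> {0<..<1}. (\<exists>W. (symmetrization u has_real_derivative W) (at x) \<and> W \<noteq> 0) \<and>
     0 < symmetrization u x \<and> (\<forall>y\<in>{-1<..<1}. u y = symmetrization u x \<longrightarrow>
        (\<exists>D. (u has_real_derivative D) (at y) \<and> D \<noteq> 0))}"

lemma symmetrization_borel:
  assumes "continuous_on {-1..1} u"
  shows "symmetrization u \<in> borel_measurable borel"
proof -
  define f where "f x = - symmetrization u (max 0 x)" for x
  have "mono f"
    unfolding f_def by (intro monoI) (auto intro!: symmetrization_antimono[OF assms])
  then have [measurable]: "f \<in> borel_measurable borel" by (rule borel_measurable_mono)
  have "symmetrization u = (\<lambda>x. - f \<bar>x\<bar>)"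
    using symmetrization_even[OF assms] by (auto simp: f_def abs_if fun_eq_iff)
  then show ?thesis by simp
qed

text \<open>
  At an irregular point the symmetrization takes a value from \<open>u ` N \<union> u ` C\<close>, the values of \<open>u\<close> at
  points without derivative, at the left end point (which accounts for the level \<open>0\<close>) and at critical points.
  This set is null, and the points that a function maps into a null set with a nonzero derivative form a
  null set.
\<close>

lemma irregular_points_negligible:
  assumes u: "u \<in> sobolev_W11_0"
  shows "negligible {x \<in> {0<..<1} - regular_points u. \<exists>W. (symmetrization u has_real_derivative W) (at x) \<and> W \<noteq> 0}"
proof -
  let ?w = "symmetrization u"
  have ac: "absolutely_continuous_on {-1..1} u" and u0: "u (-1) = 0"
    and ae: "AE x in lebesgue. x \<in> {-1..1} \<longrightarrow> u differentiable (at x)"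
    using u by (auto simp: sobolev_W11_0_def)
  have cont: "continuous_on {-1..1} u" by (rule absolutely_continuous_on_imp_continuous_on[OF ac])
  define N where "N = {x \<in> {-1..1}. \<not> u differentiable (at x)} \<union> {-1}"
  define C where "C = {x \<in> {-1..1}. (u has_real_derivative 0) (at x)}"
  have "negligible {x \<in> {-1..1}. \<not> u differentiable (at x)}"
    using ae unfolding eventually_ae_filter
    by (auto simp: negligible_iff_null_sets intro: null_sets_completion_subset)
  then have "negligible N" unfolding N_def by (intro negligible_Un) auto
  then have "negligible (u ` N)"
    by (intro absolutely_continuous_on_negligible_image[OF ac]) (auto simp: N_def)
  moreover have "negligible (u ` C)" by (rule critical_values_negligible) (simp add: C_def)
  ultimately have Z: "negligible (u ` N \<union> u ` C)" by (rule negligible_Un)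
  define S where "S = {x. \<exists>W. (?w has_real_derivative W) (at x) \<and> W \<noteq> 0}"
  have W: "(?w has_real_derivative deriv ?w x) (at x)" "deriv ?w x \<noteq> 0" if "x \<in> S" for x
    using that by (auto simp: S_def DERIV_imp_deriv)
  have "negligible {x \<in> S. ?w x \<in> u ` N \<union> u ` C}"
  proof (rule negligible_differentiable_vimage[OF Z])
    show "(?w has_derivative (*) (deriv ?w x)) (at x within S)" if "x \<in> S" for x
      using W[OF that] by (auto simp: has_field_derivative_def intro: has_derivative_at_withinI)
    show "inj ((*) (deriv ?w x))" if "x \<in> S" for x using W[OF that] by (simp add: inj_on_def)
  qed
  moreover have "{x \<in> {0<..<1} - regular_points u. \<exists>W. (?w has_real_derivative W) (at x) \<and> W \<noteq> 0}
      \<subseteq> {x \<in> S. ?w x \<in> u ` N \<union> u ` C}"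
  proof
    fix x assume x: "x \<in> {x \<in> {0<..<1} - regular_points u. \<exists>W. (?w has_real_derivative W) (at x) \<and> W \<noteq> 0}"
    then have xS: "x \<in> S" by (simp add: S_def)
    have "?w x \<in> u ` N \<union> u ` C"
    proof (cases "?w x = 0")
      case True
      then have "?w x = u (-1)" using u0 by simp
      then show ?thesis by (auto simp: N_def)
    next
      case False
      then have "0 < ?w x" using symmetrization_nonneg[OF cont, of x] by simp
      then obtain y where y: "y \<in> {-1<..<1}" "u y = ?w x" "\<not> (\<exists>D. (u has_real_derivative D) (at y) \<and> D \<noteq> 0)"
        using x by (auto simp: regular_points_def)
      have "y \<in> N \<union> C"
      proof (cases "u differentiable (at y)")
        case True
        then obtain D where "(u has_real_derivative D) (at y)" using real_differentiable_def by blast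
        with y show ?thesis by (cases "D = 0") (auto simp: C_def)
      qed (use y in \<open>auto simp: N_def\<close>)
      then show ?thesis using y(2) by (metis Un_iff imageI)
    qed
    with xS show "x \<in> {x \<in> S. ?w x \<in> u ` N \<union> u ` C}" by simp
  qed
  ultimately show ?thesis by (rule negligible_subset)
qed

text \<open>
  The value of \<^const>\<open>deriv\<close> is unspecified at points without derivative. Setting it to zero gives a
  function that is odd whenever \<open>v\<close> is even, and measurable whenever \<open>v\<close> is Borel measurable and
  differentiable almost everywhere.
\<close>

definition deriv_or_0 :: "(real \<Rightarrow> real) \<Rightarrow> real \<Rightarrow> real" where
  "deriv_or_0 v x = (if v differentiable (at x) then deriv v x else 0)"

lemma deriv_or_0_measurable:
  assumes v: "v \<in> borel_measurable borel" and null: "negligible {x. \<not> v differentiable (at x)}"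
  shows "deriv_or_0 v \<in> borel_measurable lebesgue"
proof (rule borel_measurable_LIMSEQ_real)
  let ?D = "- {x. \<not> v differentiable (at x)}"
  have D: "?D \<in> sets lebesgue" 
    using sets.compl_sets[OF negligible_imp_sets[OF null]] by (simp add: Compl_eq_Diff_UNIV)
  let ?q = "\<lambda>n x. indicator ?D x * ((v (x + 1 / real (Suc n)) - v x) / (1 / real (Suc n))) :: real"
  show "(\<lambda>n. ?q n x) \<longlonglongrightarrow> deriv_or_0 v x" if "x \<in> space lebesgue" for x
  proof (cases "v differentiable (at x)")
    case True
    then have "(v has_real_derivative deriv v x) (at x)"
      using DERIV_deriv_iff_real_differentiable by blast
    then have "(\<lambda>h. (v (x + h) - v x) / h) \<midarrow>0\<rightarrow> deriv v x" by (simp add: DERIV_def)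
    moreover have "filterlim (\<lambda>n. 1 / real (Suc n)) (at 0) sequentially"
      using LIMSEQ_Suc[OF lim_1_over_n] by (auto simp: filterlim_at)
    ultimately have "(\<lambda>n. (v (x + 1 / real (Suc n)) - v x) / (1 / real (Suc n))) \<longlonglongrightarrow> deriv v x"
      by (rule filterlim_compose)
    with True show ?thesis by (simp add: deriv_or_0_def)
  qed (simp add: deriv_or_0_def)
  show "?q n \<in> borel_measurable lebesgue" for n
  proof -
    note v[measurable]
    have "(\<lambda>x. (v (x + 1 / real (Suc n)) - v x) / (1 / real (Suc n))) \<in> borel_measurable lborel"
      by measurable
    then have "(\<lambda>x. (v (x + 1 / real (Suc n)) - v x) / (1 / real (Suc n))) \<in> borel_measurable lebesgue"
      by (rule measurable_completion)
    then show ?thesis using D by (intro borel_measurable_times borel_measurable_indicator) auto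
  qed
qed

lemma deriv_or_0_eq: "(v has_real_derivative D) (at x) \<Longrightarrow> deriv_or_0 v x = D"
  unfolding deriv_or_0_def using real_differentiable_def by (auto simp: DERIV_imp_deriv)

lemma deriv_or_0_even:
  assumes "\<And>x. v (- x) = v x"
  shows "deriv_or_0 v (- x) = - deriv_or_0 v x"
proof -
  have *: "(v has_real_derivative D) (at (- x)) \<longleftrightarrow> (v has_real_derivative - D) (at x)" for D
    using DERIV_mirror[of v D x] by (simp add: assms)
  show ?thesis
  proof (cases "v differentiable (at x)")
    case True
    then obtain D where D: "(v has_real_derivative D) (at x)" using real_differentiable_def by blast
    then have "(v has_real_derivative - D) (at (- x))" using *[of "- D"] by simp
    then show ?thesis using deriv_or_0_eq D by simp
  next
    case False
    then have "\<not> v differentiable (at (- x))" using * real_differentiable_def by blast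
    with False show ?thesis by (simp add: deriv_or_0_def)
  qed
qed

lemma deriv_or_0_nonzero_iff:
  "deriv_or_0 v x \<noteq> 0 \<longleftrightarrow> (\<exists>D. (v has_real_derivative D) (at x) \<and> D \<noteq> 0)"
proof
  assume nz: "deriv_or_0 v x \<noteq> 0"
  then have "v differentiable (at x)" by (metis deriv_or_0_def)
  then obtain D where "(v has_real_derivative D) (at x)" using real_differentiable_def by blast
  with nz show "\<exists>D. (v has_real_derivative D) (at x) \<and> D \<noteq> 0" using deriv_or_0_eq by blast
qed (use deriv_or_0_eq in blast)

lemma regular_points_lebesgue:
  assumes "u \<in> sobolev_W11_0"
  shows "regular_points u \<in> sets lebesgue"
proof -
  let ?w = "symmetrization u"
  have cont: "continuous_on {-1..1} u"
    using assms absolutely_continuous_on_imp_continuous_on by (auto simp: sobolev_W11_0_def)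
  let ?T = "deriv_or_0 ?w -` (- {0}) \<inter> space lebesgue"
  let ?Irr = "{x \<in> {0<..<1} - regular_points u. \<exists>W. (?w has_real_derivative W) (at x) \<and> W \<noteq> 0}"
  have "deriv_or_0 ?w \<in> borel_measurable lebesgue"
    by (intro deriv_or_0_measurable symmetrization_borel symmetrization_differentiable_ae cont)
  then have T: "?T \<in> sets lebesgue" by (rule measurable_sets) simp
  have "regular_points u = {0<..<1} \<inter> ?T - ?Irr"
    unfolding regular_points_def using deriv_or_0_nonzero_iff[of ?w] by auto
  moreover have "{0<..<1} \<inter> ?T - ?Irr \<in> sets lebesgue"
    using T negligible_imp_sets[OF irregular_points_negligible[OF assms]] by (intro sets.Diff sets.Int) auto
  ultimately show ?thesis by (rule ssubst)
qed

text \<open>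
  Evenness reduces the integral to the right half of the interval, where the derivative of the symmetrization
  vanishes at almost all points that are not regular.
\<close>

lemma nn_integral_excess_symmetrization:
  assumes u: "u \<in> sobolev_W11_0" and p: "continuous_on {-1..1} p" "\<forall>x\<in>{-1..1}. p (- x) = p x"
  shows "(\<integral>\<^sup>+x. ennreal (excess p x (deriv_or_0 (symmetrization u) x)) \<partial>lebesgue_on {-1..1})
    = (\<integral>\<^sup>+x. 2 * ennreal (excess p x (deriv_or_0 (symmetrization u) x)) \<partial>lebesgue_on (regular_points u))"
proof -
  let ?w = "symmetrization u"
  have cont: "continuous_on {-1..1} u"
    using u absolutely_continuous_on_imp_continuous_on by (auto simp: sobolev_W11_0_def)
  let ?dw = "deriv_or_0 ?w"
  define E where "E x = ennreal (excess p x (?dw x))" for x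
  define g where "g x = E x * indicator {0<..<1} x" for x
  have dw: "?dw \<in> borel_measurable lebesgue"
    by (intro deriv_or_0_measurable symmetrization_borel symmetrization_differentiable_ae cont)
  have "E \<in> borel_measurable (lebesgue_on {-1..1})"
    unfolding E_def using excess_measurable[OF p(1) measurable_restrict_space1[OF dw]] by measurable
  then have Em: "(\<lambda>x. E x * indicator {-1..1} x) \<in> borel_measurable lebesgue"
    by (subst (asm) borel_measurable_restrict_space_iff_ennreal) auto
  have "g = (\<lambda>x. E x * indicator {-1..1} x * indicator {0<..<1} x)"
    by (auto simp: g_def fun_eq_iff indicator_def)
  then have gm: "g \<in> borel_measurable lebesgue"
    using borel_measurable_times_ennreal[OF Em borel_measurable_indicator[of "{0<..<1}"]] by simp
  have gm': "(\<lambda>x. g (- x)) \<in> borel_measurable lebesgue"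
    using measurable_compose[OF lebesgue_measurable_scaling[of "-1 :: real"] gm] by simp
  have E_even: "E (- x) = E x" if "x \<in> {-1..1}" for x
    using deriv_or_0_even[of ?w x] symmetrization_even[OF cont] p(2) that
    by (simp add: E_def excess_def)
  have "AE x in lebesgue. x \<notin> {-1, 0, 1::real}"
    by (rule AE_not_in) (auto intro!: null_sets_completionI finite_imp_null_set_lborel)
  then have split: "AE x in lebesgue. E x * indicator {-1..1} x = g x + g (- x)"
  proof (rule AE_mp, intro AE_I2 impI)
    fix x :: real assume "x \<notin> {-1, 0, 1}"
    then consider "x < -1" | "-1 < x \<and> x < 0" | "0 < x \<and> x < 1" | "1 < x" by force
    then show "E x * indicator {-1..1} x = g x + g (- x)"
      by cases (auto simp: g_def E_even)
  qed
  have "(\<integral>\<^sup>+x. E x \<partial>lebesgue_on {-1..1}) = (\<integral>\<^sup>+x. E x * indicator {-1..1} x \<partial>lebesgue)"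
    by (rule nn_integral_restrict_space) simp
  also have "\<dots> = (\<integral>\<^sup>+x. g x + g (- x) \<partial>lebesgue)" by (rule nn_integral_cong_AE[OF split])
  also have "\<dots> = (\<integral>\<^sup>+x. g x \<partial>lebesgue) + (\<integral>\<^sup>+x. g (- x) \<partial>lebesgue)"
    by (rule nn_integral_add[OF gm gm'])
  also have "\<dots> = 2 * (\<integral>\<^sup>+x. g x \<partial>lebesgue)"
    by (simp add: nn_integral_lebesgue_reflect[OF gm] mult_2)
  also have "\<dots> = (\<integral>\<^sup>+x. 2 * g x \<partial>lebesgue)" by (rule nn_integral_cmult[symmetric, OF gm])
  also have "\<dots> = (\<integral>\<^sup>+x. 2 * E x * indicator (regular_points u) x \<partial>lebesgue)"
  proof (rule nn_integral_cong_AE)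
    let ?Irr = "{x \<in> {0<..<1} - regular_points u. \<exists>W. (?w has_real_derivative W) (at x) \<and> W \<noteq> 0}"
    have "AE x in lebesgue. x \<notin> ?Irr"
      using irregular_points_negligible[OF u] by (intro AE_not_in) (simp add: negligible_iff_null_sets)
    then show "AE x in lebesgue. 2 * g x = 2 * E x * indicator (regular_points u) x"
    proof (rule AE_mp, intro AE_I2 impI)
      fix x assume x: "x \<notin> ?Irr"
      show "2 * g x = 2 * E x * indicator (regular_points u) x"
      proof (cases "x \<in> {0<..<1} - regular_points u")
        case True
        then have "?dw x = 0" using x deriv_or_0_nonzero_iff[of ?w x] by blast
        then have "E x = 0" by (simp add: E_def)
        then show ?thesis by (simp add: g_def)
      next
        case False
        moreover have "regular_points u \<subseteq> {0<..<1}" by (auto simp: regular_points_def)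
        ultimately have "x \<in> regular_points u \<longleftrightarrow> x \<in> {0<..<1}" by blast
        then show ?thesis by (simp add: g_def indicator_def mult.assoc)
      qed
    qed
  qed
  also have "\<dots> = (\<integral>\<^sup>+x. 2 * E x \<partial>lebesgue_on (regular_points u))"
    using regular_points_lebesgue[OF u] by (intro nn_integral_restrict_space[symmetric]) simp
  finally show ?thesis unfolding E_def .
qed

theorem theorem3:
  fixes p u :: "real \<Rightarrow> real"
  assumes "continuous_on {-1..1} p"
    and "\<forall>x\<in>{-1..1}. p x \<ge> 1"
    and "\<forall>x\<in>{-1..1}. p (- x) = p x"
    and "convex_on ({0<..} \<times> {-1..1}) (\<lambda>(s, x). s * (1 + s powi (-2)) powr (p x / 2))"
    and "u \<in> sobolev_W11_0"
    and "\<forall>x\<in>{-1..1}. u x \<ge> 0"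
  shows "energy p (symmetrization u) \<le> energy p u"
proof -
  let ?w = "symmetrization u" and ?l = "left_branch u" and ?r = "right_branch u"
  let ?I = "{-1..1} :: real set" and ?B = "regular_points u"
  have cont: "continuous_on ?I u" and u0: "u (-1) = 0" and u1: "u 1 = 0"
    and int: "set_integrable lebesgue ?I (deriv u)"
    using assms(5) absolutely_continuous_on_imp_continuous_on by (auto simp: sobolev_W11_0_def)
  note mid = cont u0 u1 assms(6)
  define f where "f x = excess p x (deriv u x)" for x
  have f0: "0 \<le> f x" if "x \<in> ?I" for x
    using assms(2) that by (auto simp: f_def intro!: excess_nonneg order_trans[of 0 1 "p x"])

  have du: "deriv u \<in> borel_measurable (lebesgue_on ?I)"
    using borel_measurable_integrable[OF int[unfolded set_integrable_def]]
    by (subst borel_measurable_restrict_space_iff) auto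
  have eu: "energy p u = 2 + (\<integral>\<^sup>+x. ennreal (f x) \<partial>lebesgue_on ?I)"
    unfolding f_def by (rule energy_eq_excess[OF assms(1,2) du]) simp
  have fm: "f \<in> borel_measurable (lebesgue_on ?I)"
    unfolding f_def by (rule excess_measurable[OF assms(1) du])

  have "AE x in lebesgue. x \<notin> {x. \<not> ?w differentiable (at x)}"
    using symmetrization_differentiable_ae[OF cont] by (intro AE_not_in) (simp add: negligible_iff_null_sets)
  then have "AE x in lebesgue. deriv ?w x = deriv_or_0 ?w x"
    by (rule AE_mp) (auto simp: deriv_or_0_def)
  then have ae: "AE x in lebesgue_on ?I. deriv ?w x = deriv_or_0 ?w x"
    by (subst AE_restrict_space_iff) (auto elim: AE_mp)
  have dw: "deriv_or_0 ?w \<in> borel_measurable (lebesgue_on ?I)"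
    by (intro measurable_restrict_space1 deriv_or_0_measurable symmetrization_borel
        symmetrization_differentiable_ae cont)
  have ew: "energy p ?w = 2 + (\<integral>\<^sup>+x. 2 * ennreal (excess p x (deriv_or_0 ?w x)) \<partial>lebesgue_on ?B)"
    using energy_eq_excess[OF assms(1,2) dw ae] nn_integral_excess_symmetrization[OF assms(5,1,3)] by simp

  show ?thesis
  proof (cases "(\<integral>\<^sup>+x. ennreal (f x) \<partial>lebesgue_on ?I) = \<infinity>")
    case True
    then show ?thesis by (simp add: eu)
  next
    case False
    have fint: "integrable (lebesgue_on ?I) f"
      using False by (intro integrableI_nonneg fm AE_I2 f0) (auto simp: less_top)
    then have fabs: "f absolutely_integrable_on ?I"
      by (subst (asm) integrable_restrict_space) (auto simp: set_integrable_def)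
    have fI: "(\<integral>\<^sup>+x. ennreal (f x) \<partial>lebesgue_on ?I) = ennreal (integral ?I f)"
      using fint f0 by (subst nn_integral_eq_integral) (auto simp: lebesgue_integral_eq_integral)

    have W: "0 < x" "x < 1" "0 < ?w x" "(?w has_real_derivative deriv_or_0 ?w x) (at x)" "deriv_or_0 ?w x < 0"
      if "x \<in> ?B" for x
    proof -
      obtain D where D: "(?w has_real_derivative D) (at x)" "D \<noteq> 0"
        using \<open>x \<in> ?B\<close> by (auto simp: regular_points_def)
      then have eq: "deriv_or_0 ?w x = D" by (intro deriv_or_0_eq)
      show x: "0 < x" "x < 1" "0 < ?w x" using \<open>x \<in> ?B\<close> by (auto simp: regular_points_def)
      show "(?w has_real_derivative deriv_or_0 ?w x) (at x)" using D(1) by (simp add: eq)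
      show "deriv_or_0 ?w x < 0"
        unfolding eq by (rule symmetrization_deriv_neg[OF cont x(1) D])
    qed
    \<comment> \<open>\<open>branch_derivs\<close> provides the two rates separately for every \<open>x\<close>; as derivatives of the branches
      they become functions of \<open>x\<close>.\<close>
    define a b where "a x = - deriv ?l x" and "b x = deriv ?r x" for x
    have ab: "0 < a x" "0 < b x" "a x + b x \<le> 2"
        "(?l has_real_derivative - a x) (at x)" "(?r has_real_derivative b x) (at x)"
        "deriv u (?l x) = - deriv_or_0 ?w x / a x" "deriv u (?r x) = deriv_or_0 ?w x / b x"
      if "x \<in> ?B" for x
    proof -
      note x = that
      have reg: "\<exists>D. (u has_real_derivative D) (at y) \<and> D \<noteq> 0" if "y \<in> {-1<..<1}" "u y = ?w x" for y
        using x that by (auto simp: regular_points_def)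
      obtain a' b' where *: "0 < a'" "0 < b'" "a' + b' \<le> 2"
        "(?l has_real_derivative - a') (at x)" "(?r has_real_derivative b') (at x)"
        "deriv u (?l x) = - deriv_or_0 ?w x / a'" "deriv u (?r x) = deriv_or_0 ?w x / b'"
        using branch_derivs[OF mid W(1)[OF x] less_imp_le[OF W(2)[OF x]] W(3,4)[OF x]
            less_imp_neq[OF W(5)[OF x]] reg] .
      have "a' = a x" "b' = b x"
        using DERIV_imp_deriv[OF *(4)] DERIV_imp_deriv[OF *(5)] by (simp_all add: a_def b_def)
      with * show "0 < a x" "0 < b x" "a x + b x \<le> 2"
        "(?l has_real_derivative - a x) (at x)" "(?r has_real_derivative b x) (at x)"
        "deriv u (?l x) = - deriv_or_0 ?w x / a x" "deriv u (?r x) = deriv_or_0 ?w x / b x" by simp_all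
    qed
    have lev: "-1 < ?l x" "?r x < 1" "u (?l x) = ?w x" "u (?r x) = ?w x" "2 * x \<le> ?r x - ?l x" if "x \<in> ?B" for x
      using branch_level[OF mid W(1) less_imp_le[OF W(2)] W(3)] that by auto
    have sub: "?l ` ?B \<subseteq> ?I" "?r ` ?B \<subseteq> ?I"
      using lev(1,2,5) W(1) by (force simp: image_subset_iff)+
    have winj: "inj_on ?w ?B"
      by (rule symmetrization_inj_on[OF cont, where W = "deriv_or_0 ?w"]) (use W in force)+
    have linj: "inj_on ?l ?B" and rinj: "inj_on ?r ?B"
      using winj lev(3,4) unfolding inj_on_def by metis+
    have disj: "?l ` ?B \<inter> ?r ` ?B = {}"
    proof -
      have "?l x \<noteq> ?r y" if "x \<in> ?B" "y \<in> ?B" for x y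
      proof
        assume eq: "?l x = ?r y"
        then have "?w x = ?w y" using lev(3)[OF that(1)] lev(4)[OF that(2)] by simp
        then have "x = y" using winj that by (auto dest: inj_onD)
        with eq lev(5)[OF that(1)] W(1)[OF that(1)] show False by simp
      qed
      then show ?thesis by blast
    qed
    note L = absolutely_integrable_branch[OF fabs regular_points_lebesgue[OF assms(5)] ab(4) linj sub(1)]
      and R = absolutely_integrable_branch[OF fabs regular_points_lebesgue[OF assms(5)] ab(5) rinj sub(2)]
    define h where "h x = \<bar>- a x\<bar> * f (?l x) + \<bar>b x\<bar> * f (?r x)" for x
    have habs: "h absolutely_integrable_on ?B"
      unfolding h_def by (intro set_integral_add L(1) R(1))
    have h0: "0 \<le> h x" if "x \<in> ?B" for x
      using f0 sub that by (auto simp: h_def image_subset_iff intro!: add_nonneg_nonneg mult_nonneg_nonneg)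
    have "integral ?B h = integral (?l ` ?B) f + integral (?r ` ?B) f"
      unfolding h_def using L R by (subst integral_add) (auto simp: absolutely_integrable_on_def)
    also have "\<dots> = integral (?l ` ?B \<union> ?r ` ?B) f"
      using L(3) R(3) disj by (intro integral_Un[symmetric]) (auto simp: absolutely_integrable_on_def)
    \<comment> \<open>Whatever \<open>u\<close> does off the two branches only adds to its energy.\<close>
    also have "\<dots> \<le> integral ?I f"
    proof (rule integral_subset_le)
      show "f integrable_on ?l ` ?B \<union> ?r ` ?B"
        using L(3) R(3) disj by (intro integrable_Un) (auto simp: absolutely_integrable_on_def)
    qed (use sub fabs f0 in \<open>auto simp: absolutely_integrable_on_def\<close>)
    finally have le: "integral ?B h \<le> integral ?I f" .

    have "(\<integral>\<^sup>+x. 2 * ennreal (excess p x (deriv_or_0 ?w x)) \<partial>lebesgue_on ?B) \<le> (\<integral>\<^sup>+x. ennreal (h x) \<partial>lebesgue_on ?B)"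
    proof (rule nn_integral_mono)
      fix x assume "x \<in> space (lebesgue_on ?B)"
      then have x: "x \<in> ?B" by (simp add: space_restrict_space)
      let ?q = "- deriv_or_0 ?w x"
      have "2 * excess p x ?q \<le> a x * excess p (?l x) (?q / a x) + b x * excess p (?r x) (?q / b x)"
        by (rule excess_two_branches[OF assms(2,3,4)])
          (use ab[OF x] lev[OF x] W[OF x] in auto)
      moreover have "excess p x ?q = excess p x (deriv_or_0 ?w x)" by (simp add: excess_def)
      moreover have "excess p (?r x) (?q / b x) = f (?r x)" "excess p (?l x) (?q / a x) = f (?l x)"
        using ab(6,7)[OF x] by (simp_all add: f_def excess_def)
      ultimately have "2 * excess p x (deriv_or_0 ?w x) \<le> h x"
        using ab(1,2)[OF x] by (simp add: h_def)
      then have "ennreal (2 * excess p x (deriv_or_0 ?w x)) \<le> ennreal (h x)" by (rule ennreal_leI)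
      then show "2 * ennreal (excess p x (deriv_or_0 ?w x)) \<le> ennreal (h x)"
        by (simp add: ennreal_mult' flip: ennreal_numeral)
    qed
    also have "\<dots> = ennreal (integral ?B h)"
    proof -
      have B: "?B \<in> sets lebesgue" by (rule regular_points_lebesgue[OF assms(5)])
      have "integrable (lebesgue_on ?B) h"
        using habs B by (subst integrable_restrict_space) (auto simp: set_integrable_def)
      then show ?thesis
        using h0 B by (subst nn_integral_eq_integral) (auto simp: lebesgue_integral_eq_integral space_restrict_space)
    qed
    also have "\<dots> \<le> (\<integral>\<^sup>+x. ennreal (f x) \<partial>lebesgue_on ?I)"
      unfolding fI by (rule ennreal_leI[OF le])
    finally show ?thesis unfolding eu ew by (rule add_left_mono)
  qed
qed

end
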